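(* Let $(A,\alpha)$ be an injective unital C*-dynamical system of multiplicity $d>1$. Let $AVT(A,\alpha)$ be the set of the tracial states $\tau\in T(A)$ such that $$\tau(a)=\frac1d\sum_{i=1}^d\tau\alpha_i(a)\quad\text{for all }a\in A,$$ and let $AVT(\mathcal{O}(A,\alpha)^\gamma)$ be the set of the tracial states $\varphi\in T(\mathcal{O}(A,\alpha)^\gamma)$ such that $$\varphi(f)=\frac1d\sum_{i=1}^d\varphi(S_i^*fS_i)\quad\text{for all }f\in\mathcal{O}(A,\alpha)^\gamma.$$ Then there is an affine weak*-homeomorphism between the three simplices of $AVT(A,\alpha)$, of $AVT(\mathcal{O}(A,\alpha)^\gamma)$, and of the $(\sigma,\log d)$-KMS states on $\mathcal{O}(A,\alpha)$.
   Context: A unital C*-dynamical system $(A,\alpha)$ of multiplicity $d$ consists of a unital C*-algebra $A$ and $d$ unital $*$-endomorphisms $\alpha_1,\dots,\alpha_d$ of $A$ ($d<\infty$). It is injective if $\bigcap_{i=1}^d\ker\alpha_i=(0)$. $T(B)$ denotes the set of tracial states of a C*-algebra $B$. For an injective unital system, $\mathcal{O}(A,\alpha)$ (the Cuntz-Pimsner algebra) is the universal C*-algebra generated by $A$ and elements $S_1,\dots,S_d$ such that $[S_1,\dots,S_d]$ is a row unitary ($S_i^*S_j=\delta_{i,j}1$ and $\sum_{i=1}^dS_iS_i^*=1$) and $aS_i=S_i\alpha_i(a)$ for all $a\in A$, $i=1,\dots,d$. The algebra $A$ embeds in it isometrically and the unit of $A$ is its unit. The gauge action $\gamma=\{\gamma_z\}_{z\in\mathbb{T}}$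 satisfies $\gamma_z(a)=a$, $\gamma_z(S_i)=zS_i$; $\mathcal{O}(A,\alpha)^\gamma$ is its fixed point algebra, and $\sigma:\mathbb{R}\to\mathrm{Aut}(\mathcal{O}(A,\alpha))$ is $\sigma_t=\gamma_{e^{it}}$. For $\beta\in\mathbb{R}$, a state $\psi$ on a C*-algebra $B$ with an action $\sigma$ of $\mathbb{R}$ is a $(\sigma,\beta)$-KMS state if $\psi(xy)=\psi(y\sigma_{i\beta}(x))$ for all $x,y$ in a norm-dense $\sigma$-invariant $*$-subalgebra of the analytic elements of $B$ (elements $x$ for which $t\mapsto\sigma_t(x)$ extends to an entire function $z\mapsto\sigma_z(x)$). *)

theory Defs
  imports "HOL-Analysis.Analysis" "HOL-Algebra.Module"
begin

section \<open>C*-algebras\<close>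

text \<open>
  Nonzero unital C*-algebras as a type class. The real scalar multiplication and the unit of norm
  one come from \<^class>\<open>real_normed_algebra_1\<close>, completeness from \<^class>\<open>banach\<close>.
\<close>

class cstar_algebra = real_normed_algebra_1 + banach +
  fixes scaleC :: "complex \<Rightarrow> 'a \<Rightarrow> 'a" (infixr "*\<^sub>C" 75)
    and star :: "'a \<Rightarrow> 'a"
  assumes scaleC_add_right: "c *\<^sub>C (x + y) = c *\<^sub>C x + c *\<^sub>C y"
    and scaleC_add_left: "(b + c) *\<^sub>C x = b *\<^sub>C x + c *\<^sub>C x"
    and scaleC_scaleC: "b *\<^sub>C c *\<^sub>C x = (b * c) *\<^sub>C x"
    and scaleR_scaleC: "r *\<^sub>R x = complex_of_real r *\<^sub>C x"
    and mult_scaleC_left: "(c *\<^sub>C x) * y = c *\<^sub>C (x * y)"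
    and mult_scaleC_right: "x * (c *\<^sub>C y) = c *\<^sub>C (x * y)"
    and norm_scaleC: "norm (c *\<^sub>C x) = cmod c * norm x"
    and star_add: "star (x + y) = star x + star y"
    and star_scaleC: "star (c *\<^sub>C x) = cnj c *\<^sub>C star x"
    and star_mult: "star (x * y) = star y * star x"
    and star_star: "star (star x) = x"
    and cstar_identity: "norm (star x * x) = (norm x)\<^sup>2"

text \<open>
  A universal property quantifies over C*-algebras inside a formula, so there they have to be
  values: records with an explicit carrier.
\<close>

record 'a cstar_struct = "(complex, 'a) module" +
  adj :: "'a \<Rightarrow> 'a"
  nrm :: "'a \<Rightarrow> real"

definition complex_ring :: "complex ring" where
  "complex_ring = \<lparr>carrier = UNIV, monoid.mult = (*), one = 1, zero = 0, add = (+)\<rparr>"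

locale unital_cstar =
  fixes D :: "'a cstar_struct" (structure)
  assumes ring: "ring D"
    and module: "module complex_ring D"
    and smult_mult_left: "\<lbrakk>x \<in> carrier D; y \<in> carrier D\<rbrakk> \<Longrightarrow> (c \<odot> x) \<otimes> y = c \<odot> (x \<otimes> y)"
    and smult_mult_right: "\<lbrakk>x \<in> carrier D; y \<in> carrier D\<rbrakk> \<Longrightarrow> x \<otimes> (c \<odot> y) = c \<odot> (x \<otimes> y)"
    and adj_closed: "x \<in> carrier D \<Longrightarrow> adj D x \<in> carrier D"
    and adj_add: "\<lbrakk>x \<in> carrier D; y \<in> carrier D\<rbrakk> \<Longrightarrow> adj D (x \<oplus> y) = adj D x \<oplus> adj D y"
    and adj_smult: "x \<in> carrier D \<Longrightarrow> adj D (c \<odot> x) = cnj c \<odot> adj D x"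
    and adj_mult: "\<lbrakk>x \<in> carrier D; y \<in> carrier D\<rbrakk> \<Longrightarrow> adj D (x \<otimes> y) = adj D y \<otimes> adj D x"
    and adj_adj: "x \<in> carrier D \<Longrightarrow> adj D (adj D x) = x"
    and nrm_nonneg: "x \<in> carrier D \<Longrightarrow> 0 \<le> nrm D x"
    and nrm_eq_zero: "x \<in> carrier D \<Longrightarrow> nrm D x = 0 \<longleftrightarrow> x = \<zero>"
    and nrm_add: "\<lbrakk>x \<in> carrier D; y \<in> carrier D\<rbrakk> \<Longrightarrow> nrm D (x \<oplus> y) \<le> nrm D x + nrm D y"
    and nrm_smult: "x \<in> carrier D \<Longrightarrow> nrm D (c \<odot> x) = cmod c * nrm D x"
    and nrm_mult: "\<lbrakk>x \<in> carrier D; y \<in> carrier D\<rbrakk> \<Longrightarrow> nrm D (x \<otimes> y) \<le> nrm D x * nrm D y"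
    and nrm_adj_mult: "x \<in> carrier D \<Longrightarrow> nrm D (adj D x \<otimes> x) = (nrm D x)\<^sup>2"
    and complete: "Metric_space.mcomplete (carrier D) (\<lambda>x y. nrm D (x \<ominus> y))"

definition cstar_of :: "'a::cstar_algebra cstar_struct" where
  "cstar_of = \<lparr>carrier = UNIV, monoid.mult = (*), one = 1, zero = 0, add = (+), smult = (*\<^sub>C),
     adj = star, nrm = norm\<rparr>"

lemma cstar_of_sel [simp]:
  "carrier cstar_of = UNIV" "x \<otimes>\<^bsub>cstar_of\<^esub> y = x * y" "x \<oplus>\<^bsub>cstar_of\<^esub> y = x + y"
  "\<one>\<^bsub>cstar_of\<^esub> = 1" "\<zero>\<^bsub>cstar_of\<^esub> = 0" "c \<odot>\<^bsub>cstar_of\<^esub> x = c *\<^sub>C x"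
  "adj cstar_of = star" "nrm cstar_of = norm"
  by (simp_all add: cstar_of_def)

lemma ring_cstar_of: "ring (cstar_of :: 'a::cstar_algebra cstar_struct)"
proof (rule ringI)
  show "abelian_group (cstar_of :: 'a cstar_struct)"
    by (rule abelian_groupI) (auto simp: add.assoc add.commute intro: exI[of _ "- _"] left_minus)
  show "Group.monoid (cstar_of :: 'a cstar_struct)"
    by (rule monoidI) (auto simp: mult.assoc)
qed (auto simp: algebra_simps)

lemma minus_cstar_of [simp]: "x \<ominus>\<^bsub>cstar_of\<^esub> y = x - (y::'a::cstar_algebra)"
proof -
  interpret ring "cstar_of :: 'a cstar_struct" by (rule ring_cstar_of)
  have "\<ominus>\<^bsub>cstar_of\<^esub> y = - y"
    using minus_equality[of "-y" y] by simp
  then show ?thesis by (simp add: a_minus_def)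
qed

lemma cring_complex: "cring complex_ring"
proof (rule cringI)
  show "abelian_group complex_ring"
    unfolding complex_ring_def
    by (rule abelian_groupI) (auto simp: add.assoc add.commute intro: exI[of _ "- _"] left_minus)
  show "comm_monoid complex_ring"
    unfolding complex_ring_def by (rule comm_monoidI) auto
qed (auto simp: complex_ring_def algebra_simps)

lemma unital_cstar_cstar_of: "unital_cstar (cstar_of :: 'a::cstar_algebra cstar_struct)"
proof -
  interpret ring "cstar_of :: 'a cstar_struct" by (rule ring_cstar_of)
  have one: "(1::complex) *\<^sub>C (x::'a) = x" for x
    using scaleR_scaleC[of 1 x] by simp
  have m: "module complex_ring (cstar_of :: 'a cstar_struct)"
    by (rule moduleI[OF cring_complex is_abelian_group])
       (auto simp: complex_ring_def scaleC_add_left scaleC_add_right scaleC_scaleC one)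
  have c: "Metric_space.mcomplete UNIV (\<lambda>x y::'a. norm (x - y))"
    using mcomplete_iff_complete[where 'a='a] complete_UNIV unfolding dist_norm by blast
  show ?thesis
    by (intro unital_cstar.intro ring_cstar_of m)
       (simp_all add: c mult_scaleC_left mult_scaleC_right norm_scaleC star_add
         star_scaleC star_mult star_star cstar_identity norm_triangle_ineq norm_mult_ineq)
qed

definition unital_star_hom ::
    "('a, 'm) cstar_struct_scheme \<Rightarrow> ('b, 'n) cstar_struct_scheme \<Rightarrow> ('a \<Rightarrow> 'b) \<Rightarrow> bool" where
  "unital_star_hom D E f \<longleftrightarrow> f \<in> ring_hom D E \<and>
     (\<forall>c. \<forall>x\<in>carrier D. f (c \<odot>\<^bsub>D\<^esub> x) = c \<odot>\<^bsub>E\<^esub> f x) \<and>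
     (\<forall>x\<in>carrier D. f (adj D x) = adj E (f x))"

lemma unital_star_hom_cstar_of:
  "unital_star_hom cstar_of cstar_of f \<longleftrightarrow>
     (\<forall>x y. f (x * y) = f x * f y) \<and> (\<forall>x y. f (x + y) = f x + f y) \<and> f 1 = 1 \<and>
     (\<forall>c x. f (c *\<^sub>C x) = c *\<^sub>C f x) \<and> (\<forall>x. f (star x) = star (f x))"
  by (auto simp: unital_star_hom_def ring_hom_def)

definition star_subalgebra :: "'a::cstar_algebra set \<Rightarrow> bool" where
  "star_subalgebra M \<longleftrightarrow> 0 \<in> M \<and>
     (\<forall>x\<in>M. \<forall>y\<in>M. x + y \<in> M \<and> x * y \<in> M) \<and>
     (\<forall>x\<in>M. star x \<in> M \<and> (\<forall>c. c *\<^sub>C x \<in> M))"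

section \<open>C*-dynamical systems and their Cuntz--Pimsner algebras\<close>

definition unital_cstar_system :: "nat \<Rightarrow> (nat \<Rightarrow> 'a::cstar_algebra \<Rightarrow> 'a) \<Rightarrow> bool" where
  "unital_cstar_system d \<alpha> \<longleftrightarrow> (\<forall>i\<in>{1..d}. unital_star_hom cstar_of cstar_of (\<alpha> i))"

definition injective_system :: "nat \<Rightarrow> (nat \<Rightarrow> 'a::cstar_algebra \<Rightarrow> 'a) \<Rightarrow> bool" where
  "injective_system d \<alpha> \<longleftrightarrow> (\<Inter>i\<in>{1..d}. {a. \<alpha> i a = 0}) = {0}"

definition row_unitary :: "nat \<Rightarrow> ('b, 'm) cstar_struct_scheme \<Rightarrow> (nat \<Rightarrow> 'b) \<Rightarrow> bool" where
  "row_unitary d D T \<longleftrightarrow> (\<forall>i\<in>{1..d}. T i \<in> carrier D) \<and>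
     (\<forall>i\<in>{1..d}. \<forall>j\<in>{1..d}.
        adj D (T i) \<otimes>\<^bsub>D\<^esub> T j = (if i = j then \<one>\<^bsub>D\<^esub> else \<zero>\<^bsub>D\<^esub>)) \<and>
     (\<Oplus>\<^bsub>D\<^esub>i\<in>{1..d}. T i \<otimes>\<^bsub>D\<^esub> adj D (T i)) = \<one>\<^bsub>D\<^esub>"

definition covariant_rep ::
    "nat \<Rightarrow> (nat \<Rightarrow> 'a::cstar_algebra \<Rightarrow> 'a) \<Rightarrow> 'b cstar_struct \<Rightarrow> ('a \<Rightarrow> 'b) \<Rightarrow> (nat \<Rightarrow> 'b) \<Rightarrow> bool" where
  "covariant_rep d \<alpha> D \<pi> T \<longleftrightarrow> unital_star_hom cstar_of D \<pi> \<and> row_unitary d D T \<and>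
     (\<forall>a. \<forall>i\<in>{1..d}. \<pi> a \<otimes>\<^bsub>D\<^esub> T i = T i \<otimes>\<^bsub>D\<^esub> \<pi> (\<alpha> i a))"

lemma covariant_rep_cstar_of:
  "covariant_rep d \<alpha> cstar_of \<iota> S \<longleftrightarrow> unital_star_hom cstar_of cstar_of \<iota> \<and>
   (\<forall>i\<in>{1..d}. \<forall>j\<in>{1..d}. star (S i) * S j = (if i = j then 1 else (0::'b::cstar_algebra))) \<and>
   (\<Sum>i=1..d. S i * star (S i)) = 1 \<and> (\<forall>a. \<forall>i\<in>{1..d}. \<iota> a * S i = S i * \<iota> (\<alpha> i a))"
proof -
  interpret ring "cstar_of :: 'b cstar_struct" by (rule ring_cstar_of)
  have "(\<Oplus>\<^bsub>cstar_of\<^esub>i\<in>I. f i) = sum f I" if "finite I" for I and f :: "nat \<Rightarrow> 'b"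
    using that by (induction) (auto simp: finsum_insert)
  then show ?thesis by (simp add: covariant_rep_def row_unitary_def)
qed

text \<open>
  The type \<^typ>\<open>'b\<close>, together with the canonical maps \<open>\<iota>\<close> and \<open>S\<close>, is the universal C*-algebra of the
  system. The second condition is the isometric embedding of the coefficient algebra, the third
  says that the coefficient algebra and the \<open>S i\<close> generate, the last is the universal property.

  Letting \<open>D\<close> range over the C*-algebras carried by subsets of \<^typ>\<open>'b\<close> is no restriction. Replacing
  the target by the C*-subalgebra generated by \<open>\<pi>\<close> and \<open>T\<close>, one may assume that its density
  character is at most that of \<^typ>\<open>'a\<close>. A Banach space of infinite density character \<open>\<kappa>\<close> has
  cardinality \<open>\<kappa>\<close> to the power aleph-zero, so the target has at most as many elements as \<^typ>\<open>'a\<close>,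
  hence (\<open>\<iota>\<close> being injective) at most as many as \<^typ>\<open>'b\<close>.
\<close>

definition cuntz_pimsner ::
    "nat \<Rightarrow> (nat \<Rightarrow> 'a::cstar_algebra \<Rightarrow> 'a) \<Rightarrow> ('a \<Rightarrow> 'b::cstar_algebra) \<Rightarrow> (nat \<Rightarrow> 'b) \<Rightarrow> bool" where
  "cuntz_pimsner d \<alpha> \<iota> S \<longleftrightarrow>
     covariant_rep d \<alpha> cstar_of \<iota> S \<and>
     (\<forall>a. norm (\<iota> a) = norm a) \<and>
     (\<lambda>M. star_subalgebra M \<and> closed M) hull (range \<iota> \<union> S ` {1..d}) = UNIV \<and>
     (\<forall>D :: 'b cstar_struct. \<forall>\<pi> T. unital_cstar D \<and> covariant_rep d \<alpha> D \<pi> T \<longrightarrow>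
        (\<exists>\<Phi>. unital_star_hom cstar_of D \<Phi> \<and> (\<forall>a. \<Phi> (\<iota> a) = \<pi> a) \<and> (\<forall>i\<in>{1..d}. \<Phi> (S i) = T i)))"

text \<open>For \<open>cmod z = 1\<close> there is exactly one such homomorphism; other \<open>z\<close> are never used.\<close>

definition gauge ::
    "nat \<Rightarrow> ('a::cstar_algebra \<Rightarrow> 'b::cstar_algebra) \<Rightarrow> (nat \<Rightarrow> 'b) \<Rightarrow> complex \<Rightarrow> 'b \<Rightarrow> 'b" where
  "gauge d \<iota> S z = (THE f. unital_star_hom cstar_of cstar_of f \<and>
     (\<forall>a. f (\<iota> a) = \<iota> a) \<and> (\<forall>i\<in>{1..d}. f (S i) = z *\<^sub>C S i))"

definition gauge_fixed ::
    "nat \<Rightarrow> ('a::cstar_algebra \<Rightarrow> 'b::cstar_algebra) \<Rightarrow> (nat \<Rightarrow> 'b) \<Rightarrow> 'b set" where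
  "gauge_fixed d \<iota> S = {x. \<forall>z. cmod z = 1 \<longrightarrow> gauge d \<iota> S z x = x}"

definition gauge_flow ::
    "nat \<Rightarrow> ('a::cstar_algebra \<Rightarrow> 'b::cstar_algebra) \<Rightarrow> (nat \<Rightarrow> 'b) \<Rightarrow> real \<Rightarrow> 'b \<Rightarrow> 'b" where
  "gauge_flow d \<iota> S t = gauge d \<iota> S (cis t)"

section \<open>States\<close>

text \<open>
  \<open>M\<close> is a C*-subalgebra containing the unit. Functionals on \<open>M\<close> are extensional functions, and
  states are the positive linear functionals of norm one; as \<open>1 \<in> M\<close>, the norm is attained at \<open>1\<close>.
\<close>

definition states :: "'a::cstar_algebra set \<Rightarrow> ('a \<Rightarrow> complex) set" where
  "states M = {\<phi> \<in> extensional M.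
     (\<forall>x\<in>M. \<forall>y\<in>M. \<phi> (x + y) = \<phi> x + \<phi> y) \<and>
     (\<forall>c. \<forall>x\<in>M. \<phi> (c *\<^sub>C x) = c * \<phi> x) \<and>
     (\<forall>x\<in>M. \<phi> (star x * x) \<in> nonneg_Reals) \<and>
     (\<forall>x\<in>M. cmod (\<phi> x) \<le> norm x) \<and> \<phi> 1 = 1}"

definition tracial_states :: "'a::cstar_algebra set \<Rightarrow> ('a \<Rightarrow> complex) set" where
  "tracial_states M = {\<phi> \<in> states M. \<forall>x\<in>M. \<forall>y\<in>M. \<phi> (x * y) = \<phi> (y * x)}"

definition AVT_coeff :: "nat \<Rightarrow> (nat \<Rightarrow> 'a::cstar_algebra \<Rightarrow> 'a) \<Rightarrow> ('a \<Rightarrow> complex) set" where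
  "AVT_coeff d \<alpha> = {\<tau> \<in> tracial_states UNIV. \<forall>a. \<tau> a = (1 / of_nat d) * (\<Sum>i=1..d. \<tau> (\<alpha> i a))}"

definition AVT_fixed ::
    "nat \<Rightarrow> ('a::cstar_algebra \<Rightarrow> 'b::cstar_algebra) \<Rightarrow> (nat \<Rightarrow> 'b) \<Rightarrow> ('b \<Rightarrow> complex) set" where
  "AVT_fixed d \<iota> S = {\<phi> \<in> tracial_states (gauge_fixed d \<iota> S).
     \<forall>f\<in>gauge_fixed d \<iota> S. \<phi> f = (1 / of_nat d) * (\<Sum>i=1..d. \<phi> (star (S i) * f * S i))}"

definition entire_orbit :: "(real \<Rightarrow> 'b::cstar_algebra \<Rightarrow> 'b) \<Rightarrow> 'b \<Rightarrow> (complex \<Rightarrow> 'b) \<Rightarrow> bool" where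
  "entire_orbit \<sigma> x F \<longleftrightarrow> (\<forall>t. F (complex_of_real t) = \<sigma> t x) \<and>
     (\<forall>z. \<exists>D. ((\<lambda>w. inverse (w - z) *\<^sub>C (F w - F z)) \<longlongrightarrow> D) (at z))"

definition analytic_elements :: "(real \<Rightarrow> 'b::cstar_algebra \<Rightarrow> 'b) \<Rightarrow> 'b set" where
  "analytic_elements \<sigma> = {x. \<exists>F. entire_orbit \<sigma> x F}"

text \<open>
  The entire extension \<open>F\<close> of an orbit exists for \<open>x\<close> in \<open>B\<close> and is unique, so \<open>F (\<i> \<beta>)\<close> below is
  the value of the orbit of \<open>x\<close> at \<open>\<i> \<beta>\<close>.
\<close>

definition KMS_states :: "(real \<Rightarrow> 'b::cstar_algebra \<Rightarrow> 'b) \<Rightarrow> real \<Rightarrow> ('b \<Rightarrow> complex) set" where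
  "KMS_states \<sigma> \<beta> = {\<psi> \<in> states UNIV.
     \<exists>B. star_subalgebra B \<and> closure B = UNIV \<and> (\<forall>t. \<forall>x\<in>B. \<sigma> t x \<in> B) \<and>
         B \<subseteq> analytic_elements \<sigma> \<and>
         (\<forall>x\<in>B. \<forall>y\<in>B. \<forall>F. entire_orbit \<sigma> x F \<longrightarrow>
            \<psi> (x * y) = \<psi> (y * F (\<i> * complex_of_real \<beta>)))}"

section \<open>Affine weak*-homeomorphisms\<close>

definition weak_star_topology :: "'a set \<Rightarrow> ('a \<Rightarrow> complex) set \<Rightarrow> ('a \<Rightarrow> complex) topology" where
  "weak_star_topology M K = subtopology (product_topology (\<lambda>_. euclidean) M) K"

definition affine_on_functionals ::
    "'a set \<Rightarrow> ('a \<Rightarrow> complex) set \<Rightarrow> 'b set \<Rightarrow> (('a \<Rightarrow> complex) \<Rightarrow> 'b \<Rightarrow> complex) \<Rightarrow> bool" where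
  "affine_on_functionals M K N h \<longleftrightarrow> (\<forall>\<phi>\<in>K. \<forall>\<psi>\<in>K. \<forall>t\<in>{0..1::real}.
     h (\<lambda>x\<in>M. of_real t * \<phi> x + of_real (1 - t) * \<psi> x) =
     (\<lambda>y\<in>N. of_real t * h \<phi> y + of_real (1 - t) * h \<psi> y))"

definition affinely_weak_star_homeomorphic ::
    "'a set \<Rightarrow> ('a \<Rightarrow> complex) set \<Rightarrow> 'b set \<Rightarrow> ('b \<Rightarrow> complex) set \<Rightarrow> bool" where
  "affinely_weak_star_homeomorphic M K N L \<longleftrightarrow>
     (\<exists>h. homeomorphic_map (weak_star_topology M K) (weak_star_topology N L) h \<and>
          affine_on_functionals M K N h)"

end

(* A state is (\<sigma>, log d)-KMS iff d^p \<psi>(x y) = d^q \<psi>(y x) for x in the span of the S_w a S_v^* with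
   |w| = p and |v| = q: the KMS identity passes from x in the unknown dense subalgebra to the spectral
   components of x, because the mean of a 2\<pi>-periodic entire function over a horizontal period does not
   depend on the height. Taking x = S_i, such a \<psi> is invariant under the transfer operator
   L f = (1/d) \<Sum>_i S_i^* f S_i, and L^n maps the span for |w| = |v| = n into A; hence \<psi> is determined by
   its restriction \<tau> to A. Conversely an averaging trace \<tau> defines \<psi>(x) = \<tau>(L^n E x), with E the
   gauge-invariant part, on the dense *-algebra spanned by the S_w a S_v^*; this is contractive because L
   and E are and A embeds isometrically, so it extends to the whole algebra. All three simplices are
   therefore related by restriction maps. *)

theory Submission
  imports Defs "HOL-Complex_Analysis.Conformal_Mappings"
begin

section \<open>C*-algebras\<close>

text \<open>The value log d is forced: tested on S_i and S_i^*, the KMS identity compares S_i^* S_i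
  = 1 with the projection S_i S_i^* up to a factor e^\<beta>, and the d projections sum to 1, so d =
  e^\<beta>.

  The elements S_w a S_v^* satisfy linear relations: each is a sum of d elements of the same kind
  with longer words. Hence a functional cannot simply be prescribed on them. Bidegrees are therefore
  introduced by a membership test (compression by the S_i must land in the image of A), which avoids
  words altogether, and the averaging condition on \<tau> is exactly what makes the values computed
  at different lengths agree. The norm bound comes before positivity: it yields the continuous
  extension, whose positivity is then checked on the dense part only.\<close>

lemma scaleC_one [simp]: "1 *\<^sub>C x = (x::'a::cstar_algebra)"
  using scaleR_scaleC[of 1 x] by simp

lemma scaleC_zero_left [simp]: "0 *\<^sub>C x = (0::'a::cstar_algebra)"
  using scaleR_scaleC[of 0 x] by simp

lemma bounded_bilinear_scaleC: "bounded_bilinear ((*\<^sub>C) :: complex \<Rightarrow> 'a::cstar_algebra \<Rightarrow> 'a)"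
proof
  fix r :: real and c :: complex and x :: 'a
  show "(r *\<^sub>R c) *\<^sub>C x = r *\<^sub>R c *\<^sub>C x" "c *\<^sub>C r *\<^sub>R x = r *\<^sub>R c *\<^sub>C x"
    by (simp_all add: scaleR_scaleC scaleC_scaleC scaleR_conv_of_real mult.commute)
  show "\<exists>K. \<forall>c x. norm (c *\<^sub>C (x::'a)) \<le> norm c * norm x * K"
    by (intro exI[of _ 1]) (simp add: norm_scaleC)
qed (simp_all add: scaleC_add_left scaleC_add_right)

interpretation scaleC: bounded_bilinear "(*\<^sub>C) :: complex \<Rightarrow> 'a::cstar_algebra \<Rightarrow> 'a"
  by (rule bounded_bilinear_scaleC)

lemma norm_star [simp]: "norm (star x) = norm (x::'a::cstar_algebra)"
proof -
  have "norm y \<le> norm (star y)" for y :: 'a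
  proof (cases "y = 0")
    case False
    have "norm y * norm y \<le> norm (star y) * norm y"
      using norm_mult_ineq[of "star y" y] by (simp add: cstar_identity power2_eq_square)
    then show ?thesis using False by simp
  qed simp
  from this[of x] this[of "star x"] show ?thesis by (simp add: star_star)
qed

lemma star_scaleR: "star (r *\<^sub>R x) = r *\<^sub>R star (x::'a::cstar_algebra)"
  by (simp add: scaleR_scaleC star_scaleC)

lemma bounded_linear_star: "bounded_linear (star :: 'a::cstar_algebra \<Rightarrow> 'a)"
  by (rule bounded_linear_intro[of _ 1]) (simp_all add: star_add star_scaleR)

lemmas star_tendsto = bounded_linear.tendsto[OF bounded_linear_star]
  and star_continuous_on = bounded_linear.continuous_on[OF bounded_linear_star]
  and star_zero = linear_0[OF bounded_linear.linear[OF bounded_linear_star]]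
  and star_diff = linear_diff[OF bounded_linear.linear[OF bounded_linear_star]]
  and star_sum = linear_sum[OF bounded_linear.linear[OF bounded_linear_star]]

lemma star_one [simp]: "star (1::'a::cstar_algebra) = 1"
  by (metis mult.right_neutral star_mult star_star)

section \<open>Square roots and contractivity of star homomorphisms\<close>

lemma norm_le_one_of_isometry:
  assumes "star u * u = (1::'a::cstar_algebra)"
  shows "norm u \<le> 1"
  using cstar_identity[of u] assms by (auto simp: power2_eq_1_iff)

text \<open>With \<open>y = 1 - k\<close> the equation \<open>y\<^sup>2 = 1 - h\<^sup>2\<close> is the fixed point equation
  \<open>k = (h\<^sup>2 + k\<^sup>2) / 2\<close> of a contraction.\<close>

lemma sqrt_one_minus_square:
  fixes h :: "'a::cstar_algebra"
  assumes h: "star h = h" and less: "norm h < 1"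
  obtains y where "star y = y" "h * y = y * h" "h * h + y * y = 1"
proof -
  \<comment> \<open>\<open>s\<close> is the smaller root of s = (norm h ^ 2 + s ^ 2) / 2, so the
    ball of radius \<open>s\<close> is mapped into itself, and \<open>s < 1\<close> is also the
    Lipschitz constant there.\<close>
  define s where "s = 1 - sqrt (1 - (norm h)\<^sup>2)"
  have n1: "(norm h)\<^sup>2 < 1" using less by (simp add: power_less_one_iff abs_square_less_1)
  then have s: "0 \<le> s" "s < 1" by (simp_all add: s_def)
  have "(1 - s)\<^sup>2 = 1 - (norm h)\<^sup>2" using n1 by (simp add: s_def)
  then have ss: "((norm h)\<^sup>2 + s * s) / 2 = s" by (simp add: power2_eq_square algebra_simps)
  define X where "X = {k. norm k \<le> s \<and> star k = k \<and> h * k = k * h}"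
  define f where "f k = (1/2) *\<^sub>R (h * h + k * k)" for k
  have "\<exists>!k\<in>X. f k = k"
  proof (rule Banach_fix)
    have "closed X" unfolding X_def
      by (intro closed_Collect_conj closed_Collect_le closed_Collect_eq continuous_intros
          star_continuous_on)
    then show "complete X" by (simp add: complete_eq_closed)
    show "X \<noteq> {}" using s by (auto simp: X_def star_zero intro!: exI[of _ 0])
    show "f ` X \<subseteq> X"
    proof safe
      fix k assume k: "k \<in> X"
      have "norm (h * h + k * k) \<le> (norm h)\<^sup>2 + s * s"
        using k s by (intro norm_triangle_mono order_trans[OF norm_mult_ineq] mult_mono)
          (auto simp: X_def power2_eq_square)
      then have "norm (f k) \<le> s" using ss by (simp add: f_def)
      moreover have "star (f k) = f k" using k h
        by (simp add: f_def X_def star_scaleR star_add star_mult)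
      moreover have "h * f k = f k * h" using k
        by (simp add: f_def X_def algebra_simps) (metis mult.assoc)
      ultimately show "f k \<in> X" by (simp add: X_def)
    qed
    fix k l assume kl: "k \<in> X" "l \<in> X"
    have "k * k - l * l = k * (k - l) + (k - l) * l" by (simp add: algebra_simps)
    also have "norm \<dots> \<le> s * norm (k - l) + norm (k - l) * s"
      using kl s by (intro norm_triangle_mono order_trans[OF norm_mult_ineq] mult_mono)
        (auto simp: X_def)
    finally have "norm (k * k - l * l) \<le> 2 * s * norm (k - l)" by simp
    moreover have "f k - f l = (1/2) *\<^sub>R (k * k - l * l)"
      by (simp add: f_def algebra_simps)
    ultimately show "dist (f k) (f l) \<le> s * dist k l" by (simp add: dist_norm)
  qed (use s in auto)
  then obtain k where k: "k \<in> X" "f k = k" by blast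
  have "2 *\<^sub>R k = h * h + k * k" using arg_cong[OF k(2), of "\<lambda>z. 2 *\<^sub>R z"] by (simp add: f_def)
  then have "h * h + (1 - k) * (1 - k) = 1" by (simp add: algebra_simps scaleR_2)
  moreover have "star (1 - k) = 1 - k" "h * (1 - k) = (1 - k) * h"
    using k by (simp_all add: X_def star_diff algebra_simps)
  ultimately show thesis using that by blast
qed

text \<open>Self-adjoint commuting \<open>a, b\<close> with \<open>a\<^sup>2 + b\<^sup>2 = 1\<close> make \<open>u = a + \<i> b\<close> unitary, and \<open>a\<close> is
  the mean of \<open>u\<close> and \<open>u\<^sup>*\<close>.\<close>

lemma norm_le_one_of_square_sum:
  fixes a b :: "'a::cstar_algebra"
  assumes "star a = a" "star b = b" "a * b = b * a" "a * a + b * b = 1"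
  shows "norm a \<le> 1"
proof -
  define u where "u = a + \<i> *\<^sub>C b"
  have su: "star u = a - \<i> *\<^sub>C b"
    using assms by (simp add: u_def star_add star_scaleC scaleC.minus_left)
  have "star u * u = 1" unfolding su unfolding u_def
    using assms by (simp add: algebra_simps mult_scaleC_left mult_scaleC_right scaleC_scaleC
        scaleC.minus_left scaleC.diff_right)
  then have "norm u \<le> 1" by (rule norm_le_one_of_isometry)
  moreover have "2 *\<^sub>R a = u + star u" unfolding su by (simp add: u_def scaleR_2)
  then have "2 * norm a = norm (u + star u)" by (metis norm_scaleR abs_numeral)
  ultimately show ?thesis using norm_triangle_ineq[of u "star u"] by simp
qed

lemma
  assumes f: "unital_star_hom cstar_of cstar_of (f :: 'a::cstar_algebra \<Rightarrow> 'b::cstar_algebra)"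
  shows star_hom_add: "f (x + y) = f x + f y"
    and star_hom_mult: "f (x * y) = f x * f y"
    and star_hom_one: "f 1 = 1"
    and star_hom_scaleC: "f (c *\<^sub>C x) = c *\<^sub>C f x"
    and star_hom_scaleR: "f (r *\<^sub>R x) = r *\<^sub>R f x"
    and star_hom_star: "f (star x) = star (f x)"
  using f by (simp_all add: unital_star_hom_cstar_of scaleR_scaleC)

text \<open>The equation h^2 + y^2 = 1 survives under \<open>f\<close> and forces norm at most 1 in
  the target, which settles self-adjoint elements of norm below 1 without spectral theory. The
  C*-identity reduces a general \<open>x\<close> to \<open>star x * x\<close>.\<close>

lemma star_hom_norm_le:
  assumes f: "unital_star_hom cstar_of cstar_of (f :: 'a::cstar_algebra \<Rightarrow> 'b::cstar_algebra)"
  shows "norm (f x) \<le> norm x"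
proof -
  note hom = star_hom_add[OF f] star_hom_mult[OF f] star_hom_one[OF f] star_hom_star[OF f]
    star_hom_scaleR[OF f]
  have sa: "norm (f h) \<le> 1" if h: "star h = h" "norm h < 1" for h
  proof -
    obtain y where y: "star y = y" "h * y = y * h" "h * h + y * y = 1"
      using sqrt_one_minus_square[OF h] .
    show ?thesis using h y
      by (intro norm_le_one_of_square_sum[where b = "f y"]) (simp_all flip: hom)
  qed
  have "norm (f x) < c" if c: "norm x < c" for c
  proof -
    have c0: "c > 0" using c norm_ge_zero[of x] by linarith
    \<comment> \<open>\<open>b\<close> leaves room on both sides: \<open>x'\<close> has norm
      strictly below 1, as the square root requires, and the resulting bound \<open>b\<close> is
      still below \<open>c\<close>.\<close>
    obtain b where b: "norm x < b" "b < c" using dense[OF c] by blast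
    have b0: "b > 0" using b(1) norm_ge_zero[of x] by linarith
    define x' where "x' = (1/b) *\<^sub>R x"
    have "norm x' < 1" using b b0 by (simp add: x'_def)
    then have "norm (star x' * x') < 1" by (simp add: cstar_identity abs_square_less_1)
    then have "norm (f (star x' * x')) \<le> 1"
      by (intro sa) (simp_all add: star_mult star_star)
    then have "norm (f x') \<le> 1"
      by (simp add: hom cstar_identity power2_eq_square abs_square_le_1[symmetric])
         (metis abs_norm_cancel abs_square_le_1 power2_eq_square)
    then show ?thesis using b b0 by (simp add: x'_def hom field_simps)
  qed
  then show ?thesis by (meson leI less_irrefl)
qed

lemma star_hom_bounded_linear:
  assumes f: "unital_star_hom cstar_of cstar_of (f :: 'a::cstar_algebra \<Rightarrow> 'b::cstar_algebra)"
  shows "bounded_linear f"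
  by (rule bounded_linear_intro[of _ 1])
    (simp_all add: star_hom_add[OF f] star_hom_scaleR[OF f] star_hom_norm_le[OF f])

lemma star_subalgebra_closure:
  assumes M: "star_subalgebra (M :: 'a::cstar_algebra set)"
  shows "star_subalgebra (closure M)"
proof -
  have "x + y \<in> closure M \<and> x * y \<in> closure M" if "x \<in> closure M" "y \<in> closure M" for x y
  proof -
    from that obtain f g where "f \<longlonglongrightarrow> x" "\<And>n. f n \<in> M" "g \<longlonglongrightarrow> y" "\<And>n. g n \<in> M"
      unfolding closure_sequential by blast
    then show ?thesis using M unfolding closure_sequential star_subalgebra_def
      by (intro conjI exI[of _ "\<lambda>n. f n + g n"] exI[of _ "\<lambda>n. f n * g n"] allI tendsto_intros) auto
  qed
  moreover have "star x \<in> closure M \<and> c *\<^sub>C x \<in> closure M" if "x \<in> closure M" for x c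
  proof -
    from that obtain f where "f \<longlonglongrightarrow> x" "\<And>n. f n \<in> M"
      unfolding closure_sequential by blast
    then show ?thesis using M unfolding closure_sequential star_subalgebra_def
      by (intro conjI exI[of _ "\<lambda>n. star (f n)"] exI[of _ "\<lambda>n. c *\<^sub>C f n"] allI
          star_tendsto scaleC.tendsto tendsto_const) auto
  qed
  ultimately show ?thesis using M closure_subset[of M]
    by (auto simp: star_subalgebra_def)
qed

section \<open>Bidegrees and the gauge action\<close>

locale cuntz_pimsner_algebra =
  fixes d :: nat
    and \<alpha> :: "nat \<Rightarrow> 'a::cstar_algebra \<Rightarrow> 'a"
    and \<iota> :: "'a \<Rightarrow> 'b::cstar_algebra"
    and S :: "nat \<Rightarrow> 'b"
  assumes d: "d > 1" and cuntz_pimsner: "cuntz_pimsner d \<alpha> \<iota> S"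
begin

declare One_nat_def [simp del]

section \<open>Consequences of the defining relations\<close>

lemma covariant: "covariant_rep d \<alpha> cstar_of \<iota> S"
  using cuntz_pimsner by (simp add: cuntz_pimsner_def)

lemma iota_hom: "unital_star_hom cstar_of cstar_of \<iota>"
  using covariant by (simp add: covariant_rep_cstar_of)

lemmas iota_add = star_hom_add[OF iota_hom] and iota_mult = star_hom_mult[OF iota_hom]
  and iota_one = star_hom_one[OF iota_hom] and iota_scaleC = star_hom_scaleC[OF iota_hom]
  and iota_scaleR = star_hom_scaleR[OF iota_hom] and iota_star = star_hom_star[OF iota_hom]

lemma iota_norm: "norm (\<iota> a) = norm a"
  using cuntz_pimsner by (simp add: cuntz_pimsner_def)

lemma iota_zero: "\<iota> 0 = 0"
  using iota_norm[of 0] by simp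

lemma iota_sum: "\<iota> (sum f I) = (\<Sum>i\<in>I. \<iota> (f i))"
  by (rule linear_sum[OF bounded_linear.linear[OF star_hom_bounded_linear[OF iota_hom]]])

lemma iota_eq_iff: "\<iota> a = \<iota> b \<longleftrightarrow> a = b"
proof
  assume "\<iota> a = \<iota> b"
  then have "\<iota> (a - b) = 0"
    using linear_diff[OF bounded_linear.linear[OF star_hom_bounded_linear[OF iota_hom]]] by simp
  then show "a = b" using iota_norm[of "a - b"] by simp
qed simp

lemma inv_iota [simp]: "inv_into UNIV \<iota> (\<iota> a) = a"
  by (rule inv_f_f) (simp add: inj_def iota_eq_iff)

lemma S_orth: "\<lbrakk>i \<in> {1..d}; j \<in> {1..d}\<rbrakk> \<Longrightarrow> star (S i) * S j = (if i = j then 1 else 0)"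
  and S_sum: "(\<Sum>i=1..d. S i * star (S i)) = 1"
  and iota_S: "i \<in> {1..d} \<Longrightarrow> \<iota> a * S i = S i * \<iota> (\<alpha> i a)"
  using covariant by (auto simp: covariant_rep_cstar_of)

lemma norm_S_le: "i \<in> {1..d} \<Longrightarrow> norm (S i) \<le> 1"
  by (rule norm_le_one_of_isometry) (simp add: S_orth)

lemma iota_alpha: "i \<in> {1..d} \<Longrightarrow> star (S i) * \<iota> a * S i = \<iota> (\<alpha> i a)"
  by (simp add: mult.assoc iota_S) (simp add: S_orth flip: mult.assoc)

lemma sum_S_left: "(\<Sum>i=1..d. S i * (star (S i) * x)) = x"
  by (simp add: S_sum flip: mult.assoc sum_distrib_right)

lemma sum_S_right: "(\<Sum>i=1..d. x * S i * star (S i)) = x"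
  by (simp add: S_sum mult.assoc flip: sum_distrib_left)

lemma sum_S_mid: "(\<Sum>i=1..d. (x * S i) * (star (S i) * y)) = x * y"
  by (subst (2) sum_S_left[of y, symmetric]) (simp add: sum_distrib_left mult.assoc)

text \<open>The elements \<open>x\<close> with \<open>S\<^sub>w\<^sup>* x S\<^sub>v \<in> \<iota> A\<close> for all words of lengths \<open>\<bar>w\<bar> = p\<close>, \<open>\<bar>v\<bar> = q\<close>; these
  are the combinations of the \<open>S\<^sub>w \<iota> a S\<^sub>v\<^sup>*\<close>.\<close>

primrec left_deg :: "nat \<Rightarrow> 'b set" where
  "left_deg 0 = range \<iota>"
| "left_deg (Suc p) = {x. \<forall>i\<in>{1..d}. star (S i) * x \<in> left_deg p}"

primrec bideg :: "nat \<Rightarrow> nat \<Rightarrow> 'b set" where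
  "bideg p 0 = left_deg p"
| "bideg p (Suc q) = {x. \<forall>i\<in>{1..d}. x * S i \<in> bideg p q}"

text \<open>Follows the two recursions: the left length grows only while the right length is 0.
  \<open>bideg_Suc_left\<close> makes peeling on the left available at every right length.\<close>

lemma bideg_induct:
  assumes "P 0 0" "\<And>p. P p 0 \<Longrightarrow> P (Suc p) 0" "\<And>p q. P p q \<Longrightarrow> P p (Suc q)"
  shows "P p q"
proof (induction q arbitrary: p)
  case 0
  show ?case by (induction p) (use assms in auto)
qed (use assms in auto)

lemma bideg_Suc_left: "x \<in> bideg (Suc p) q \<longleftrightarrow> (\<forall>i\<in>{1..d}. star (S i) * x \<in> bideg p q)"
  by (induction q arbitrary: x) (auto simp: mult.assoc)

lemma bideg_zero: "0 \<in> bideg p q"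
  by (induction p q rule: bideg_induct) (auto intro!: rev_image_eqI[of 0] simp: iota_zero)

lemma bideg_add: "\<lbrakk>x \<in> bideg p q; y \<in> bideg p q\<rbrakk> \<Longrightarrow> x + y \<in> bideg p q"
  by (induction p q arbitrary: x y rule: bideg_induct)
    (auto simp: distrib_left distrib_right simp flip: iota_add)

lemma bideg_scaleC: "x \<in> bideg p q \<Longrightarrow> c *\<^sub>C x \<in> bideg p q"
  by (induction p q arbitrary: x rule: bideg_induct)
    (auto simp: mult_scaleC_left mult_scaleC_right simp flip: iota_scaleC)

lemma bideg_scaleR: "x \<in> bideg p q \<Longrightarrow> r *\<^sub>R x \<in> bideg p q"
  by (simp add: scaleR_scaleC bideg_scaleC)

lemma bideg_sum: "(\<And>i. i \<in> I \<Longrightarrow> f i \<in> bideg p q) \<Longrightarrow> sum f I \<in> bideg p q"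
  by (induction I rule: infinite_finite_induct) (auto simp: bideg_zero bideg_add)

lemma bideg_star: "x \<in> bideg p q \<Longrightarrow> star x \<in> bideg q p"
proof (induction p q arbitrary: x rule: bideg_induct)
  case 1
  then show ?case by (auto simp flip: iota_star)
next
  case (2 p)
  have "star x * S i \<in> bideg 0 p" if "i \<in> {1..d}" for i
    using 2(1)[of "star (S i) * x"] 2(2) that by (simp add: star_mult star_star)
  then show ?case by simp
next
  case (3 p q)
  have "star (S i) * star x \<in> bideg q p" if "i \<in> {1..d}" for i
    using 3(1)[of "x * S i"] 3(2) that by (simp add: star_mult)
  then show ?case by (simp add: bideg_Suc_left)
qed

text \<open>By covariance a is the sum of the S_i \<alpha>_i(a) S_i^*, which lengthens both words by
  the same letter. For the compressions this reads S_j^* a S_i = \<delta>_ij \<alpha>_i(a).\<close>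

lemma bideg_Suc: "x \<in> bideg p q \<Longrightarrow> x \<in> bideg (Suc p) (Suc q)"
proof (induction p q arbitrary: x rule: bideg_induct)
  case 1
  then obtain a where a: "x = \<iota> a" by auto
  have "star (S j) * (x * S i) \<in> range \<iota>" if "i \<in> {1..d}" "j \<in> {1..d}" for i j
    using that by (simp add: a iota_S S_orth flip: mult.assoc)
      (metis iota_zero rangeI)
  then show ?case by (simp add: mult.assoc)
next
  case (2 p)
  then show ?case unfolding bideg_Suc_left by blast
next
  case (3 p q)
  then show ?case unfolding bideg.simps(2) by blast
qed

lemma bideg_raise: "x \<in> bideg p q \<Longrightarrow> x \<in> bideg (p + k) (q + k)"
  by (induction k) (simp_all add: bideg_Suc del: bideg.simps)

text \<open>The inner length q is removed by inserting the sum of the S_i S_i^* between the factors;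
  the outer lengths p and r are only carried along by associativity.\<close>

lemma bideg_mult: "\<lbrakk>x \<in> bideg p q; y \<in> bideg q r\<rbrakk> \<Longrightarrow> x * y \<in> bideg p r"
proof (induction p arbitrary: x)
  case 0
  then show ?case
  proof (induction r arbitrary: y)
    case 0
    then show ?case
    proof (induction q arbitrary: x y)
      case 0
      then show ?case by (auto simp flip: iota_mult)
    next
      case (Suc q)
      have "(x * S i) * (star (S i) * y) \<in> bideg 0 0" if "i \<in> {1..d}" for i
        using Suc.prems that by (intro Suc.IH) simp_all
      then have "(\<Sum>i=1..d. (x * S i) * (star (S i) * y)) \<in> bideg 0 0" by (rule bideg_sum)
      then show ?case by (simp only: sum_S_mid)
    qed
  next
    case (Suc r)
    then show ?case by (simp add: mult.assoc)
  qed
next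
  case (Suc p)
  then show ?case by (simp add: bideg_Suc_left flip: mult.assoc)
qed

lemma bideg_iota: "\<iota> a \<in> bideg 0 0"
  by simp

lemma bideg_S: "i \<in> {1..d} \<Longrightarrow> S i \<in> bideg 1 0"
  by (auto simp: One_nat_def S_orth intro: rev_image_eqI[of 0] rev_image_eqI[of 1] iota_zero[symmetric] iota_one[symmetric])

text \<open>The algebraic part of degree m. Raising both lengths turns the spaces with p - q = m
  into an increasing chain, which is why this union is closed under addition.\<close>

definition homog :: "int \<Rightarrow> 'b set" where
  "homog m = {x. \<exists>p q. int p - int q = m \<and> x \<in> bideg p q}"

lemma homogI: "x \<in> bideg p q \<Longrightarrow> x \<in> homog (int p - int q)"
  by (auto simp: homog_def)

lemma homog_zero: "0 \<in> homog m"
  using homogI[OF bideg_zero[of "nat m" "nat (- m)"]] by (simp split: if_splits)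

lemma homog_add:
  assumes "x \<in> homog m" "y \<in> homog m" shows "x + y \<in> homog m"
proof -
  obtain p q r s where pq: "int p - int q = m" "x \<in> bideg p q"
    and rs: "int r - int s = m" "y \<in> bideg r s"
    using assms by (auto simp: homog_def)
  have "s + p = q + r" using pq(1) rs(1) by linarith
  then have "x + y \<in> bideg (p + r) (q + r)"
    using bideg_raise[OF pq(2), of r] bideg_raise[OF rs(2), of p] bideg_add
    by (simp add: add.commute)
  from homogI[OF this] pq(1) show ?thesis by simp
qed

lemma homog_mult:
  assumes "x \<in> homog m" "y \<in> homog n" shows "x * y \<in> homog (m + n)"
proof -
  obtain p q r s where pq: "int p - int q = m" "x \<in> bideg p q"
    and rs: "int r - int s = n" "y \<in> bideg r s"
    using assms by (auto simp: homog_def)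
  have "x * y \<in> bideg (p + r) (q + s)"
    using bideg_mult[OF bideg_raise[OF pq(2), of r]] bideg_raise[OF rs(2), of q]
    by (simp add: add.commute)
  from homogI[OF this] pq(1) rs(1) show ?thesis by (simp add: algebra_simps)
qed

lemma homog_star: "x \<in> homog m \<Longrightarrow> star x \<in> homog (- m)"
  by (force simp: homog_def dest: bideg_star)

text \<open>Addition is the only closure rule: scalar multiples, adjoints and products of elements
  with a bidegree have a bidegree again. Inductions thus have two cases only.\<close>

inductive_set core :: "'b set" where
  bideg: "x \<in> bideg p q \<Longrightarrow> x \<in> core"
| add: "\<lbrakk>x \<in> core; y \<in> core\<rbrakk> \<Longrightarrow> x + y \<in> core"

lemma bideg_mult_core: "\<lbrakk>x \<in> bideg p q; y \<in> bideg r s\<rbrakk> \<Longrightarrow> x * y \<in> core"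
  using homog_mult[OF homogI homogI] core.bideg by (fastforce simp: homog_def simp del: bideg.simps)

lemma star_subalgebra_core: "star_subalgebra core"
proof -
  have mult: "x * y \<in> core" if "x \<in> core" "y \<in> core" for x y
    using that(1)
  proof induction
    case (bideg x p q)
    show ?case using that(2)
      by induction (auto simp: distrib_left intro: bideg_mult_core[OF bideg] core.add)
  qed (auto simp: distrib_right intro: core.add)
  have "star x \<in> core" if "x \<in> core" for x
    using that by induction (auto simp: star_add intro: core.add core.bideg bideg_star)
  moreover have "c *\<^sub>C x \<in> core" if "x \<in> core" for x c
    using that by induction (auto simp: scaleC_add_right intro: core.add core.bideg bideg_scaleC)
  ultimately show ?thesis
    using core.bideg[OF bideg_zero] by (simp add: star_subalgebra_def mult core.add)
qed

section \<open>Density of the core and the gauge automorphisms\<close>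

lemma closed_subalgebra_eq_UNIV:
  assumes "star_subalgebra M" "closed M" "range \<iota> \<union> S ` {1..d} \<subseteq> M"
  shows "M = UNIV"
proof -
  have "(\<lambda>M. star_subalgebra M \<and> closed M) hull (range \<iota> \<union> S ` {1..d}) \<subseteq> M"
    using assms by (intro hull_minimal) auto
  then show ?thesis using cuntz_pimsner by (simp add: cuntz_pimsner_def top.extremum_unique)
qed

lemma closure_core: "closure core = UNIV"
proof (rule closed_subalgebra_eq_UNIV)
  show "star_subalgebra (closure core)"
    by (intro star_subalgebra_closure star_subalgebra_core)
  show "range \<iota> \<union> S ` {1..d} \<subseteq> closure core"
    using closure_subset core.bideg[OF bideg_iota] core.bideg[OF bideg_S] by blast
qed simp

lemma core_approx:
  assumes "e > 0" obtains y where "y \<in> core" "norm (x - y) < e"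
  using closure_approachable[of x core] closure_core assms
  by (metis UNIV_I dist_norm norm_minus_commute)

lemma hom_eqI:
  assumes f: "unital_star_hom cstar_of cstar_of (f :: 'b \<Rightarrow> 'b)"
    and g: "unital_star_hom cstar_of cstar_of g"
    and iota: "\<And>a. f (\<iota> a) = g (\<iota> a)" and S: "\<And>i. i \<in> {1..d} \<Longrightarrow> f (S i) = g (S i)"
  shows "f = g"
proof -
  have "{x. f x = g x} = UNIV"
  proof (rule closed_subalgebra_eq_UNIV)
    have "f 0 = g 0" using iota[of 0] by (simp add: iota_zero)
    then show "star_subalgebra {x. f x = g x}"
      by (simp add: star_subalgebra_def star_hom_add[OF f] star_hom_add[OF g]
        star_hom_mult[OF f] star_hom_mult[OF g] star_hom_scaleC[OF f] star_hom_scaleC[OF g]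
        star_hom_star[OF f] star_hom_star[OF g])
    show "closed {x. f x = g x}"
      by (rule closed_Collect_eq[OF linear_continuous_on[OF star_hom_bounded_linear[OF f]]
            linear_continuous_on[OF star_hom_bounded_linear[OF g]]])
  qed (use iota S in auto)
  then show ?thesis by (simp add: set_eq_iff fun_eq_iff)
qed

text \<open>For |z| = 1 the z S_i form a row unitary covariant with the same \<open>\<iota>\<close>,
  so the universal property, with the algebra itself as target, gives \<open>f\<close>; it is unique
  because A and the S_i generate.\<close>

lemma gauge_exists:
  assumes z: "cmod z = 1"
  shows "\<exists>!f. unital_star_hom cstar_of cstar_of f \<and>
     (\<forall>a. f (\<iota> a) = \<iota> a) \<and> (\<forall>i\<in>{1..d}. f (S i) = z *\<^sub>C S i)"
proof -
  have zz: "cnj z * z = 1" "z * cnj z = 1"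
    using complex_norm_square[of z] z by (simp_all add: mult.commute)
  have "covariant_rep d \<alpha> cstar_of \<iota> (\<lambda>i. z *\<^sub>C S i)"
    unfolding covariant_rep_cstar_of
    using iota_hom S_sum
    by (auto simp: star_scaleC mult_scaleC_left mult_scaleC_right scaleC_scaleC zz S_orth iota_S)
  then have "\<exists>f. unital_star_hom cstar_of cstar_of f \<and>
     (\<forall>a. f (\<iota> a) = \<iota> a) \<and> (\<forall>i\<in>{1..d}. f (S i) = z *\<^sub>C S i)"
    using cuntz_pimsner unital_cstar_cstar_of unfolding cuntz_pimsner_def by blast
  then show ?thesis
  proof (rule ex_ex1I)
    fix f g
    assume "unital_star_hom cstar_of cstar_of f \<and>
        (\<forall>a. f (\<iota> a) = \<iota> a) \<and> (\<forall>i\<in>{1..d}. f (S i) = z *\<^sub>C S i)"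
      "unital_star_hom cstar_of cstar_of g \<and>
        (\<forall>a. g (\<iota> a) = \<iota> a) \<and> (\<forall>i\<in>{1..d}. g (S i) = z *\<^sub>C S i)"
    then show "f = g" by (intro hom_eqI) simp_all
  qed
qed

lemma
  assumes "cmod z = 1"
  shows gauge_hom: "unital_star_hom cstar_of cstar_of (gauge d \<iota> S z)"
    and gauge_iota: "gauge d \<iota> S z (\<iota> a) = \<iota> a"
    and gauge_S: "i \<in> {1..d} \<Longrightarrow> gauge d \<iota> S z (S i) = z *\<^sub>C S i"
  using theI'[OF gauge_exists[OF assms]] unfolding gauge_def by blast+

text \<open>Writing x as the sum of the S_i (S_i^* x) splits off a left generator and with it a
  factor z; splitting off S_i^* on the right yields a factor \<open>cnj z\<close>.\<close>

lemma gauge_bideg: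
  assumes z: "cmod z = 1"
  shows "x \<in> bideg p q \<Longrightarrow> gauge d \<iota> S z x = (z ^ p * cnj z ^ q) *\<^sub>C x"
proof (induction p q arbitrary: x rule: bideg_induct)
  case 1
  then show ?case using gauge_iota[OF z] by auto
next
  note hom = gauge_hom[OF z]
  case (2 p)
  have "gauge d \<iota> S z x = (\<Sum>i=1..d. gauge d \<iota> S z (S i) * gauge d \<iota> S z (star (S i) * x))"
    by (subst sum_S_left[symmetric], subst linear_sum[OF bounded_linear.linear[OF star_hom_bounded_linear[OF hom]]])
      (simp add: star_hom_mult[OF hom])
  also have "\<dots> = (\<Sum>i=1..d. z ^ Suc p *\<^sub>C (S i * (star (S i) * x)))"
    using 2 by (intro sum.cong)
      (auto simp: gauge_S[OF z] mult_scaleC_left mult_scaleC_right scaleC_scaleC mult.commute)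
  finally show ?case by (simp add: sum_S_left flip: scaleC.sum_right)
next
  note hom = gauge_hom[OF z]
  case (3 p q)
  have "gauge d \<iota> S z x = (\<Sum>i=1..d. gauge d \<iota> S z (x * S i) * star (gauge d \<iota> S z (S i)))"
    by (subst sum_S_right[symmetric], subst linear_sum[OF bounded_linear.linear[OF star_hom_bounded_linear[OF hom]]])
      (simp add: star_hom_mult[OF hom] star_hom_star[OF hom])
  also have "\<dots> = (\<Sum>i=1..d. (z ^ p * cnj z ^ Suc q) *\<^sub>C (x * S i * star (S i)))"
    using 3 by (intro sum.cong)
      (auto simp: gauge_S[OF z] mult_scaleC_left mult_scaleC_right scaleC_scaleC star_scaleC mult_ac)
  finally show ?case by (simp add: sum_S_right flip: scaleC.sum_right)
qed

abbreviation \<sigma> :: "real \<Rightarrow> 'b \<Rightarrow> 'b" where "\<sigma> \<equiv> gauge_flow d \<iota> S"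

lemma sigma_hom: "unital_star_hom cstar_of cstar_of (\<sigma> t)"
  by (simp add: gauge_flow_def gauge_hom)

lemmas sigma_add = star_hom_add[OF sigma_hom] and sigma_scaleR = star_hom_scaleR[OF sigma_hom]
  and sigma_norm_le = star_hom_norm_le[OF sigma_hom]
  and sigma_diff = linear_diff[OF bounded_linear.linear[OF star_hom_bounded_linear[OF sigma_hom]]]

lemma sigma_bideg:
  assumes "x \<in> bideg p q" shows "\<sigma> t x = cis (of_int (int p - int q) * t) *\<^sub>C x"
  using gauge_bideg[OF _ assms, of "cis t"]
  by (simp add: gauge_flow_def Complex.DeMoivre cis_cnj cis_mult algebra_simps)

lemma sigma_periodic: "\<sigma> (t + 2 * pi) = \<sigma> t"
  by (simp add: gauge_flow_def flip: cis_mult)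

lemma sigma_plus: "\<sigma> (s + t) x = \<sigma> s (\<sigma> t x)"
proof -
  have "\<sigma> (s + t) = \<sigma> s \<circ> \<sigma> t"
  proof (rule hom_eqI)
    show "unital_star_hom cstar_of cstar_of (\<sigma> s \<circ> \<sigma> t)"
      using sigma_hom[of s] sigma_hom[of t] by (simp add: unital_star_hom_cstar_of)
  qed (rule sigma_hom, simp_all add: gauge_flow_def gauge_iota gauge_S star_hom_scaleC[OF gauge_hom]
      scaleC_scaleC cis_mult add.commute)
  then show ?thesis by simp
qed

text \<open>On the core the orbit is a trigonometric polynomial. Every \<open>\<sigma> t\<close> is
  contractive, so approximation of x by core elements is uniform in t.\<close>

lemma sigma_continuous: "continuous_on A (\<lambda>t. \<sigma> t x)"
proof -
  have core: "continuous_on A (\<lambda>t. \<sigma> t x)" if "x \<in> core" for x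
    using that by induction (auto simp: sigma_add sigma_bideg intro!: continuous_intros scaleC.continuous_on)
  have "x \<in> closure core" by (simp add: closure_core)
  then obtain p where p: "\<And>n. p n \<in> core" "p \<longlonglongrightarrow> x" unfolding closure_sequential by blast
  have "uniform_limit A (\<lambda>n t. \<sigma> t (p n)) (\<lambda>t. \<sigma> t x) sequentially"
    unfolding uniform_limit_iff
  proof (intro allI impI)
    fix e :: real assume "e > 0"
    with p(2) have "\<forall>\<^sub>F n in sequentially. dist (p n) x < e" by (simp add: tendsto_iff)
    then show "\<forall>\<^sub>F n in sequentially. \<forall>t\<in>A. dist (\<sigma> t (p n)) (\<sigma> t x) < e"
      by (rule eventually_mono)
        (auto simp: dist_norm simp flip: sigma_diff intro: le_less_trans[OF sigma_norm_le])
  qed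
  then show ?thesis by (intro uniform_limit_theorem[OF always_eventually]) (auto simp: core p)
qed

end

section \<open>Spectral components and the transfer operator\<close>

text \<open>Serves twice: an entire extension of an orbit inherits the period 2 \<pi> from the real
  axis, and two entire extensions agree once a functional is applied.\<close>

lemma holomorphic_eq_on_reals:
  assumes f: "f holomorphic_on UNIV" and g: "g holomorphic_on UNIV"
    and eq: "\<And>t. f (complex_of_real t) = g (complex_of_real t)"
  shows "f z = g z"
proof -
  have "(\<lambda>z. f z - g z) z = 0"
  proof (rule analytic_continuation[where f = "\<lambda>z. f z - g z" and S = UNIV and U = "\<real>" and \<xi> = 0])
    show "0 islimpt (\<real> :: complex set)"
      unfolding islimpt_approachable
    proof (intro allI impI)
      fix e :: real assume "e > 0"
      then show "\<exists>x\<in>\<real>. x \<noteq> 0 \<and> dist x (0::complex) < e"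
        by (intro bexI[of _ "of_real (e / 2)"]) auto
    qed
  qed (auto elim!: Reals_cases intro!: holomorphic_intros f g simp: eq)
  then show ?thesis by simp
qed

text \<open>If \<open>G' = f\<close> then \<open>G (z + 2 \<pi>) - G z\<close> is constant.\<close>

lemma integral_entire_periodic:
  assumes f: "f holomorphic_on UNIV" and per: "\<And>z. f (z + 2 * of_real pi) = f z"
  shows "integral {0..1} (\<lambda>s. f (w + 2 * of_real pi * of_real s)) =
    integral {0..1} (\<lambda>s. f (2 * of_real pi * of_real s))"
proof -
  obtain G where G: "\<And>z. (G has_field_derivative f z) (at z)"
    using holomorphic_convex_primitive[of UNIV "{}" f] f
    by (auto simp: holomorphic_on_imp_continuous_on holomorphic_on_imp_differentiable_at)
  note G' [derivative_intros] = DERIV_chain2[OF G]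
  have int: "integral {0..1} (\<lambda>s. f (w + 2 * of_real pi * of_real s)) =
      (G (w + 2 * of_real pi) - G w) / (2 * of_real pi)" for w
  proof -
    let ?H = "\<lambda>z. G (w + 2 * of_real pi * z) / (2 * of_real pi)"
    have "(?H has_field_derivative f (w + 2 * of_real pi * z)) (at z)" for z
      by (auto intro!: derivative_eq_intros)
    then have "((\<lambda>s. f (w + 2 * of_real pi * of_real s)) has_integral ?H (of_real 1) - ?H (of_real 0)) {0..1}"
      by (intro fundamental_theorem_of_calculus has_vector_derivative_real_field) simp_all
    then show ?thesis by (simp add: integral_unique diff_divide_distrib)
  qed
  have "((\<lambda>z. G (z + 2 * of_real pi) - G z) has_field_derivative 0) (at z)" for z
    by (auto intro!: derivative_eq_intros simp: per)
  then obtain c where c: "\<And>z. G (z + 2 * of_real pi) - G z = c"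
    using has_field_derivative_zero_constant[of UNIV "\<lambda>z. G (z + 2 * of_real pi) - G z"] by auto
  then show ?thesis using int[of w] int[of 0] c[of w] c[of 0] by simp
qed

lemma integral_cis:
  "integral {0..1} (\<lambda>s. cis (2 * pi * of_int n * s)) = (if n = 0 then 1 else 0)"
proof (cases "n = 0")
  case False
  define k where "k = 2 * of_real pi * of_int n * \<i>"
  have k: "k \<noteq> 0" using False by (simp add: k_def)
  have "((\<lambda>z. exp (k * z) / k) has_field_derivative exp (k * z)) (at z)" for z
    using k by (auto intro!: derivative_eq_intros)
  then have "((\<lambda>s. exp (k * of_real s)) has_integral
      exp (k * of_real 1) / k - exp (k * of_real 0) / k) {0..1}"
    by (intro fundamental_theorem_of_calculus has_vector_derivative_real_field) simp_all
  moreover have "exp (k * of_real 1) = 1"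
    unfolding k_def exp_eq_1 by (auto intro: exI[of _ n])
  moreover have "exp (k * of_real s) = cis (2 * pi * of_int n * s)" for s
    by (simp add: cis_conv_exp k_def mult_ac)
  ultimately show ?thesis using False by (simp add: integral_unique)
qed simp

section \<open>Fourier coefficients of the gauge flow\<close>

context cuntz_pimsner_algebra
begin

text \<open>The m-th Fourier coefficient of the orbit of x; for m = 0 this is E. The period is
  rescaled to the unit interval, so that the integral is a mean without a normalising
  factor.\<close>

definition spectral :: "int \<Rightarrow> 'b \<Rightarrow> 'b" where
  "spectral m x = integral {0..1} (\<lambda>s. cis (2 * pi * of_int (- m) * s) *\<^sub>C \<sigma> (2 * pi * s) x)"

lemma spectral_integrand_continuous:
  "continuous_on A (\<lambda>s. cis (2 * pi * of_int m * s) *\<^sub>C \<sigma> (2 * pi * s) x)"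
  by (intro scaleC.continuous_on continuous_intros continuous_on_compose2[OF sigma_continuous[of UNIV]]) auto

lemma spectral_integrable:
  "(\<lambda>s. cis (2 * pi * of_int m * s) *\<^sub>C \<sigma> (2 * pi * s) x) integrable_on {0..1}"
  by (intro integrable_continuous_real spectral_integrand_continuous)

lemma norm_spectral_le: "norm (spectral m x) \<le> norm x"
  unfolding spectral_def
  using integral_bound[of 0 1 _ "norm x", OF _ spectral_integrand_continuous[of _ "-m" x]]
  by (simp add: norm_scaleC sigma_norm_le)

lemma bounded_linear_spectral: "bounded_linear (spectral m)"
proof (rule bounded_linear_intro[of _ 1])
  show "spectral m (x + y) = spectral m x + spectral m y" for x y
    unfolding spectral_def sigma_add scaleC_add_right
    by (rule integral_add[OF spectral_integrable spectral_integrable])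
  show "spectral m (r *\<^sub>R x) = r *\<^sub>R spectral m x" for r x
    unfolding spectral_def sigma_scaleR scaleC.scaleR_right
    by (rule integral_cmul)
qed (simp add: norm_spectral_le)

lemmas spectral_add = linear_add[OF bounded_linear.linear[OF bounded_linear_spectral]]
  and spectral_diff = linear_diff[OF bounded_linear.linear[OF bounded_linear_spectral]]

lemma functional_spectral:
  assumes "bounded_linear h"
  shows "h (spectral m x) =
    integral {0..1} (\<lambda>s. h (cis (2 * pi * of_int (- m) * s) *\<^sub>C \<sigma> (2 * pi * s) x))"
  using integral_linear[OF spectral_integrable[of "- m"] assms] by (simp add: spectral_def o_def)

lemma spectral_scaleC: "spectral m (c *\<^sub>C x) = c *\<^sub>C spectral m x"
proof -
  have "spectral m (c *\<^sub>C x) =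
      integral {0..1} (\<lambda>s. c *\<^sub>C (cis (2 * pi * of_int (- m) * s) *\<^sub>C \<sigma> (2 * pi * s) x))"
    unfolding spectral_def star_hom_scaleC[OF sigma_hom] scaleC_scaleC by (simp add: mult.commute)
  then show ?thesis using functional_spectral[OF scaleC.bounded_linear_right[of c], of m x] by simp
qed

lemma spectral_bideg:
  assumes "x \<in> bideg p q"
  shows "spectral m x = (if int p - int q = m then x else 0)"
proof -
  have "spectral m x = integral {0..1} (\<lambda>s. cis (2 * pi * of_int (int p - int q - m) * s) *\<^sub>C x)"
    unfolding spectral_def
    by (intro integral_cong) (simp add: sigma_bideg[OF assms] scaleC_scaleC cis_mult algebra_simps)
  also have "\<dots> = integral {0..1} (\<lambda>s. cis (2 * pi * of_int (int p - int q - m) * s)) *\<^sub>C x"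
    using integral_linear[OF _ scaleC.bounded_linear_left[of x],
        of "\<lambda>s. cis (2 * pi * of_int (int p - int q - m) * s)" "{0..1}"]
    by (simp add: o_def integrable_continuous_real continuous_intros)
  finally show ?thesis unfolding integral_cis by simp
qed

section \<open>The fixed point algebra and the transfer operator\<close>

abbreviation "fixed \<equiv> gauge_fixed d \<iota> S"

lemma spectral_fixed: "x \<in> fixed \<Longrightarrow> spectral 0 x = x"
  by (simp add: spectral_def gauge_fixed_def gauge_flow_def)

lemma fixed_sub:
  assumes "x \<in> fixed"
  shows "y \<in> fixed \<Longrightarrow> x + y \<in> fixed" "y \<in> fixed \<Longrightarrow> x * y \<in> fixed" "star x \<in> fixed" "c *\<^sub>C x \<in> fixed" "r *\<^sub>R x \<in> fixed"
  using assms by (simp_all add: gauge_fixed_def star_hom_add[OF gauge_hom]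
      star_hom_mult[OF gauge_hom] star_hom_star[OF gauge_hom] star_hom_scaleC[OF gauge_hom]
      star_hom_scaleR[OF gauge_hom])

lemma bideg_fixed: "x \<in> bideg n n \<Longrightarrow> x \<in> fixed"
proof -
  assume "x \<in> bideg n n"
  moreover have "z ^ n * cnj z ^ n = 1" if "cmod z = 1" for z
    using complex_norm_square[of z] that by (simp flip: power_mult_distrib)
  ultimately show ?thesis by (simp add: gauge_fixed_def gauge_bideg)
qed

lemma iota_fixed: "\<iota> a \<in> fixed"
  by (rule bideg_fixed[OF bideg_iota])

lemma one_fixed: "1 \<in> fixed"
  using iota_fixed[of 1] by (simp add: iota_one)

lemma fixed_sum: "(\<And>i. i \<in> I \<Longrightarrow> f i \<in> fixed) \<Longrightarrow> sum f I \<in> fixed"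
  using bideg_fixed[OF bideg_zero]
  by (induction I rule: infinite_finite_induct) (auto simp: fixed_sub)

lemma S_fixed_S:
  assumes x: "x \<in> fixed" and i: "i \<in> {1..d}" shows "star (S i) * x * S i \<in> fixed"
proof -
  have "cnj z * z = 1" "z * cnj z = 1" if "cmod z = 1" for z
    using complex_norm_square[of z] that by (simp_all add: mult.commute)
  with x i show ?thesis
    by (simp add: gauge_fixed_def star_hom_mult[OF gauge_hom] star_hom_star[OF gauge_hom] gauge_S
        star_scaleC mult_scaleC_left mult_scaleC_right scaleC_scaleC)
qed

text \<open>Only summands with p = q survive, and finitely many diagonal levels can be raised to a
  common one.\<close>

lemma spectral_core:
  assumes "x \<in> core" obtains n where "spectral 0 x \<in> bideg n n"
proof -
  have "\<exists>n. spectral 0 x \<in> bideg n n"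
    using assms
  proof induction
    case (bideg x p q)
    then show ?case using bideg_zero by (auto simp: spectral_bideg simp del: bideg.simps)
  next
    case (add x y)
    then obtain m n where "spectral 0 x \<in> bideg m m" "spectral 0 y \<in> bideg n n" by blast
    then have "spectral 0 x \<in> bideg (m + n) (m + n)" "spectral 0 y \<in> bideg (m + n) (m + n)"
      using bideg_raise[of _ n n m] by (auto simp: add.commute intro: bideg_raise)
    then show ?case by (auto simp: spectral_add intro: bideg_add)
  qed
  then show thesis using that by blast
qed

text \<open>The map \<open>spectral 0\<close> is contractive and fixes x, so applying it to an
  approximant from the core keeps the error and makes the approximant diagonal.\<close>

lemma fixed_approx:
  assumes x: "x \<in> fixed" and e: "e > 0"
  obtains n g where "g \<in> bideg n n" "norm (x - g) < e"
proof -
  obtain y where y: "y \<in> core" "norm (x - y) < e" using core_approx[OF e] .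
  obtain n where "spectral 0 y \<in> bideg n n" using spectral_core[OF y(1)] .
  moreover have "norm (x - spectral 0 y) < e"
    using norm_spectral_le[of 0 "x - y"] y(2) by (simp add: spectral_diff spectral_fixed[OF x])
  ultimately show thesis using that by blast
qed

text \<open>The operator L. Division by d makes the sum of d contractions a contraction, and on A it
  becomes the mean of the \<alpha>_i, which is the map in the averaging condition.\<close>

definition transfer :: "'b \<Rightarrow> 'b" where
  "transfer x = (1 / real d) *\<^sub>R (\<Sum>i=1..d. star (S i) * x * S i)"

lemma transfer_add: "transfer (x + y) = transfer x + transfer y"
  by (simp add: transfer_def distrib_left distrib_right sum.distrib scaleR_right_distrib)

lemma transfer_scaleC: "transfer (c *\<^sub>C x) = c *\<^sub>C transfer x"
  by (simp add: transfer_def mult_scaleC_left mult_scaleC_right scaleC.scaleR_right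
      flip: scaleC.sum_right)

lemma norm_transfer_le: "norm (transfer x) \<le> norm x"
proof -
  have "norm (\<Sum>i=1..d. star (S i) * x * S i) \<le> (\<Sum>i=1..d. norm x)"
  proof (intro sum_norm_le)
    fix i assume i: "i \<in> {1..d}"
    have "norm (star (S i) * x * S i) \<le> norm (star (S i)) * norm x * norm (S i)"
      by (meson norm_mult_ineq mult_right_mono norm_ge_zero order_trans)
    also have "\<dots> \<le> 1 * norm x * 1"
      using norm_S_le[OF i] by (intro mult_mono) auto
    finally show "norm (star (S i) * x * S i) \<le> norm x" by simp
  qed
  then show ?thesis using d by (simp add: transfer_def field_simps)
qed

lemma transfer_iota: "transfer (\<iota> a) = \<iota> ((1 / real d) *\<^sub>R (\<Sum>i=1..d. \<alpha> i a))"
  by (simp add: transfer_def iota_scaleR iota_sum iota_alpha)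

lemma transfer_bideg: "x \<in> bideg (Suc p) (Suc q) \<Longrightarrow> transfer x \<in> bideg p q"
  unfolding transfer_def
  by (intro bideg_scaleR bideg_sum) (simp add: bideg_Suc_left mult.assoc del: bideg.simps(1))

lemma norm_funpow_transfer_le: "norm ((transfer ^^ n) x) \<le> norm x"
  by (induction n) (auto intro: order_trans[OF norm_transfer_le])

lemma funpow_transfer_add: "(transfer ^^ n) (x + y) = (transfer ^^ n) x + (transfer ^^ n) y"
  by (induction n) (auto simp: transfer_add)

lemma funpow_transfer_scaleC: "(transfer ^^ n) (c *\<^sub>C x) = c *\<^sub>C (transfer ^^ n) x"
  by (induction n) (auto simp: transfer_scaleC)

lemma funpow_transfer_bideg: "x \<in> bideg n n \<Longrightarrow> (transfer ^^ n) x \<in> range \<iota>"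
proof (induction n arbitrary: x)
  case (Suc n)
  then show ?case by (simp add: funpow_Suc_right transfer_bideg del: funpow.simps bideg.simps)
qed simp

end

section \<open>KMS states\<close>

lemma
  assumes "\<phi> \<in> states M"
  shows states_add: "\<lbrakk>x \<in> M; y \<in> M\<rbrakk> \<Longrightarrow> \<phi> (x + y) = \<phi> x + \<phi> y"
    and states_scaleC: "x \<in> M \<Longrightarrow> \<phi> (c *\<^sub>C x) = c * \<phi> x"
    and states_pos: "x \<in> M \<Longrightarrow> \<phi> (star x * x) \<in> nonneg_Reals"
    and states_norm_le: "x \<in> M \<Longrightarrow> cmod (\<phi> x) \<le> norm x"
    and states_one: "\<phi> 1 = 1"
  using assms by (simp_all add: states_def)

lemma states_bounded_linear: "\<phi> \<in> states UNIV \<Longrightarrow> bounded_linear \<phi>"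
  by (rule bounded_linear_intro[of _ 1])
    (simp_all add: states_add states_scaleC states_norm_le scaleR_scaleC scaleR_conv_of_real)

lemma states_diff_le:
  assumes M: "\<And>x y. \<lbrakk>x \<in> M; y \<in> M\<rbrakk> \<Longrightarrow> x + y \<in> M" "\<And>c x. x \<in> M \<Longrightarrow> c *\<^sub>C x \<in> M"
    and \<phi>: "\<phi> \<in> states M" and x: "x \<in> M" and y: "y \<in> M"
  shows "cmod (\<phi> x - \<phi> y) \<le> norm (x - y)"
proof -
  have "x - y = x + (-1) *\<^sub>C y" by (simp add: scaleC.minus_left)
  moreover have "\<phi> (x + (-1) *\<^sub>C y) = \<phi> x - \<phi> y" "x + (-1) *\<^sub>C y \<in> M"
    using states_add[OF \<phi> x M(2)[OF y], of "-1"] states_scaleC[OF \<phi> y, of "-1"] M x y by auto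
  ultimately have "\<phi> (x - y) = \<phi> x - \<phi> y" "x - y \<in> M" by (simp_all only:)
  then show ?thesis using states_norm_le[OF \<phi>] by metis
qed

text \<open>The bounded functional u \<mapsto> \<psi>(y u) turns norm-convergent difference
  quotients into complex ones, so that scalar function theory applies.\<close>

lemma entire_orbit_holomorphic:
  assumes F: "entire_orbit \<sigma> x F" and \<psi>: "\<psi> \<in> states UNIV"
  shows "(\<lambda>z. \<psi> (y * F z)) holomorphic_on UNIV"
proof -
  note lin = states_bounded_linear[OF \<psi>]
  have "(\<lambda>z. \<psi> (y * F z)) field_differentiable at z" for z
  proof -
    obtain D where "((\<lambda>w. inverse (w - z) *\<^sub>C (F w - F z)) \<longlongrightarrow> D) (at z)"
      using F by (auto simp: entire_orbit_def)
    then have "((\<lambda>w. \<psi> (y * (inverse (w - z) *\<^sub>C (F w - F z)))) \<longlongrightarrow> \<psi> (y * D)) (at z)"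
      by (intro bounded_linear.tendsto[OF lin] tendsto_intros)
    moreover have "\<psi> (y * (inverse (w - z) *\<^sub>C (F w - F z))) =
        (\<psi> (y * F w) - \<psi> (y * F z)) / (w - z)" for w
      by (simp add: mult_scaleC_right states_scaleC[OF \<psi>] right_diff_distrib
          linear_diff[OF bounded_linear.linear[OF lin]] divide_inverse mult.commute)
    ultimately show ?thesis by (auto simp: field_differentiable_def has_field_derivative_iff)
  qed
  then show ?thesis by (simp add: holomorphic_on_def)
qed

context cuntz_pimsner_algebra
begin

text \<open>The KMS condition at log d without analytic continuation: on bidegree (p, q) the orbit
  continued to i log d is d^(q-p) times the element. Denominators are cleared, and y ranges over the
  whole algebra.\<close>

definition graded_KMS :: "('b \<Rightarrow> complex) set" where
  "graded_KMS = {\<psi> \<in> states UNIV. \<forall>p q. \<forall>x\<in>bideg p q. \<forall>y.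
     of_nat d ^ p * \<psi> (x * y) = of_nat d ^ q * \<psi> (y * x)}"

lemma
  assumes "\<psi> \<in> graded_KMS"
  shows graded_KMS_state: "\<psi> \<in> states UNIV"
    and graded_KMS_mult: "x \<in> bideg p q \<Longrightarrow> of_nat d ^ p * \<psi> (x * y) = of_nat d ^ q * \<psi> (y * x)"
  using assms by (auto simp: graded_KMS_def)

section \<open>From an unknown dense subalgebra to spectral components\<close>

lemma entire_orbit_shift:
  assumes "entire_orbit \<sigma> x F"
  shows "entire_orbit \<sigma> (\<sigma> t x) (\<lambda>z. F (z + of_real t))"
  unfolding entire_orbit_def
proof (intro conjI allI)
  fix s show "F (of_real s + of_real t) = \<sigma> s (\<sigma> t x)"
    using assms by (simp add: entire_orbit_def flip: of_real_add sigma_plus)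
next
  fix z
  obtain D where "((\<lambda>w. inverse (w - (z + of_real t)) *\<^sub>C (F w - F (z + of_real t))) \<longlongrightarrow> D)
      (at (z + of_real t))"
    using assms unfolding entire_orbit_def by blast
  from LIM_offset[OF this, of "of_real t"]
  show "\<exists>D. ((\<lambda>w. inverse (w - z) *\<^sub>C (F (w + of_real t) - F (z + of_real t))) \<longlongrightarrow> D) (at z)"
    by auto
qed

lemma KMS_spectral_mult_dense:
  assumes \<psi>: "\<psi> \<in> states UNIV" and F: "entire_orbit \<sigma> x F"
    and KMS: "\<And>t. \<psi> (\<sigma> t x * y) = \<psi> (y * F (of_real t + \<i> * of_real \<beta>))"
  shows "exp (of_int m * of_real \<beta>) * \<psi> (spectral m x * y) = \<psi> (y * spectral m x)"
proof -
  note lin = states_bounded_linear[OF \<psi>]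
  define g where "g z = \<psi> (y * F z)" for z
  have g: "g holomorphic_on UNIV"
    unfolding g_def by (rule entire_orbit_holomorphic[OF F \<psi>])
  have Fr: "F (of_real t) = \<sigma> t x" for t using F by (simp add: entire_orbit_def)
  \<comment> \<open>The period is visible for real arguments only, where \<open>F\<close> is the
    orbit; the identity theorem carries it to the plane.\<close>
  have per: "g (z + 2 * of_real pi) = g z" for z
  proof (rule holomorphic_eq_on_reals[OF _ g])
    show "(\<lambda>z. g (z + 2 * of_real pi)) holomorphic_on UNIV"
      by (rule holomorphic_on_compose_gen[OF _ g, unfolded o_def]) (auto intro!: holomorphic_intros)
    fix t
    have "F (of_real t + 2 * of_real pi) = F (of_real (t + 2 * pi))" by simp
    then show "g (of_real t + 2 * of_real pi) = g (of_real t)"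
      unfolding g_def by (simp only: Fr sigma_periodic)
  qed
  \<comment> \<open>The factor exp (- i m z) selects the m-th Fourier coefficient on the real line;
    at height \<beta> it contributes the constant e^(m \<beta>).\<close>
  define f where "f z = exp (- \<i> * of_int m * z) * g z" for z
  have f: "f holomorphic_on UNIV" unfolding f_def by (intro holomorphic_intros g)
  have "exp (- \<i> * of_int m * (2 * of_real pi)) = 1"
    unfolding exp_eq_1 by (auto intro: exI[of _ "- m"])
  then have fper: "f (z + 2 * of_real pi) = f z" for z
    by (simp only: f_def per distrib_left exp_add mult_1_right)
  have cis: "cis (2 * pi * of_int (- m) * s) = exp (- \<i> * of_int m * (2 * of_real pi * of_real s))" for s
    by (simp add: cis_conv_exp mult_ac)
  have Fr2: "F (2 * of_real pi * of_real s) = \<sigma> (2 * pi * s) x" for s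
    using Fr[of "2 * pi * s"] by simp
  have "\<psi> (y * spectral m x) = integral {0..1} (\<lambda>s. f (2 * of_real pi * of_real s))"
    unfolding functional_spectral[OF bounded_linear_compose[OF lin bounded_linear_mult_right]]
    by (simp only: mult_scaleC_right states_scaleC[OF \<psi>] UNIV_I cis f_def g_def Fr2)
  also have "\<dots> = integral {0..1} (\<lambda>s. f (\<i> * of_real \<beta> + 2 * of_real pi * of_real s))"
    by (rule integral_entire_periodic[OF f fper, symmetric])
  also have "\<dots> = integral {0..1} (\<lambda>s. exp (of_int m * of_real \<beta>) *
      \<psi> ((cis (2 * pi * of_int (- m) * s) *\<^sub>C \<sigma> (2 * pi * s) x) * y))"
  proof (intro integral_cong)
    fix s
    have "\<psi> (\<sigma> (2 * pi * s) x * y) = g (\<i> * of_real \<beta> + 2 * of_real pi * of_real s)"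
      unfolding KMS g_def by (simp add: add.commute)
    moreover have "exp (- \<i> * of_int m * (\<i> * of_real \<beta> + 2 * of_real pi * of_real s)) =
        exp (of_int m * of_real \<beta>) * cis (2 * pi * of_int (- m) * s)"
      unfolding cis by (subst exp_add[symmetric]) (simp add: algebra_simps)
    ultimately show "f (\<i> * of_real \<beta> + 2 * of_real pi * of_real s) = exp (of_int m * of_real \<beta>) *
      \<psi> ((cis (2 * pi * of_int (- m) * s) *\<^sub>C \<sigma> (2 * pi * s) x) * y)"
      by (simp add: f_def mult_scaleC_left states_scaleC[OF \<psi>])
  qed
  also have "\<dots> = exp (of_int m * of_real \<beta>) * \<psi> (spectral m x * y)"
    unfolding functional_spectral[OF bounded_linear_compose[OF lin bounded_linear_mult_left]]
    by (rule integral_mult_right)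
  finally show ?thesis by simp
qed

text \<open>The KMS identity itself does not pass to limits in x, because the continuation to i
  \<beta> need not be bounded. For spectral components both sides are continuous in x and in y, so
  the identity extends in one variable after the other.\<close>

lemma KMS_spectral_mult:
  assumes "\<psi> \<in> KMS_states \<sigma> \<beta>"
  shows "exp (of_int m * of_real \<beta>) * \<psi> (spectral m x * y) = \<psi> (y * spectral m x)"
proof -
  from assms obtain B where \<psi>: "\<psi> \<in> states UNIV"
    and B: "star_subalgebra B" "closure B = UNIV" "\<And>t x. x \<in> B \<Longrightarrow> \<sigma> t x \<in> B"
      "B \<subseteq> analytic_elements \<sigma>"
    and KMS: "\<And>x y F. \<lbrakk>x \<in> B; y \<in> B; entire_orbit \<sigma> x F\<rbrakk> \<Longrightarrow>
      \<psi> (x * y) = \<psi> (y * F (\<i> * of_real \<beta>))"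
    unfolding KMS_states_def by blast
  note cont [continuous_intros] =
    bounded_linear.continuous_on[OF states_bounded_linear[OF \<psi>]]
    bounded_linear.continuous_on[OF bounded_linear_spectral]
  let ?eq = "\<lambda>x y. exp (of_int m * of_real \<beta>) * \<psi> (spectral m x * y) = \<psi> (y * spectral m x)"
  have BB: "?eq x y" if x: "x \<in> B" and y: "y \<in> B" for x y
  proof -
    obtain F where F: "entire_orbit \<sigma> x F" using B(4) x by (auto simp: analytic_elements_def)
    show ?thesis
      by (rule KMS_spectral_mult_dense[OF \<psi> F])
        (use KMS[OF B(3)[OF x] y entire_orbit_shift[OF F]] in \<open>simp add: add.commute\<close>)
  qed
  have "?eq x y" if y: "y \<in> B" for x y
  proof -
    have "closure B \<subseteq> {x. ?eq x y}"
      using BB y by (intro closure_minimal closed_Collect_eq continuous_intros) auto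
    then show ?thesis using B(2) by auto
  qed
  then have "closure B \<subseteq> {y. ?eq x y}"
    by (intro closure_minimal closed_Collect_eq continuous_intros) auto
  then show ?thesis using B(2) by auto
qed

section \<open>The core as a subalgebra of analytic elements\<close>

lemma exp_ln_degree:
  "exp (of_int (int p - int q) * complex_of_real (ln (real d))) = of_nat d ^ p / of_nat d ^ q"
proof -
  have "exp (complex_of_real (ln (real d))) = of_nat d"
    using d by (simp add: exp_of_real)
  then show ?thesis by (simp add: left_diff_distrib exp_diff exp_of_nat_mult)
qed

lemma sigma_core: "x \<in> core \<Longrightarrow> \<sigma> t x \<in> core"
  by (induction rule: core.induct)
    (auto simp: sigma_bideg sigma_add intro: core.intros bideg_scaleC)

text \<open>On bidegree (p, q) the orbit e^(i (p-q) t) x has an explicit entire extension, with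
  value d^(q-p) x at i log d; for sums the extensions add up.\<close>

lemma graded_KMS_orbit:
  assumes \<psi>: "\<psi> \<in> graded_KMS" and x: "x \<in> core"
  shows "\<exists>F. entire_orbit \<sigma> x F \<and> (\<forall>y. \<psi> (x * y) = \<psi> (y * F (\<i> * of_real (ln (real d)))))"
  using x
proof induction
  case (bideg x p q)
  define n where "n = int p - int q"
  define e where "e z = exp (\<i> * of_int n * z)" for z
  have orbit: "entire_orbit \<sigma> x (\<lambda>z. e z *\<^sub>C x)"
    unfolding entire_orbit_def
  proof (intro conjI allI)
    fix t show "e (of_real t) *\<^sub>C x = \<sigma> t x"
      by (simp add: sigma_bideg[OF bideg] e_def n_def cis_conv_exp mult_ac)
  next
    fix z
    have "(e has_field_derivative \<i> * of_int n * e z) (at z)"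
      unfolding e_def by (auto intro!: derivative_eq_intros)
    then have "((\<lambda>w. (inverse (w - z) * (e w - e z)) *\<^sub>C x) \<longlongrightarrow> (\<i> * of_int n * e z) *\<^sub>C x) (at z)"
      by (intro scaleC.tendsto tendsto_const) (simp add: has_field_derivative_iff divide_inverse mult.commute)
    then show "\<exists>D. ((\<lambda>w. inverse (w - z) *\<^sub>C (e w *\<^sub>C x - e z *\<^sub>C x)) \<longlongrightarrow> D) (at z)"
      by (auto simp: scaleC_scaleC simp flip: scaleC.diff_left)
  qed
  have "e (\<i> * of_real (ln (real d))) = of_nat d ^ q / of_nat d ^ p"
    unfolding exp_ln_degree[symmetric] e_def n_def by (simp add: algebra_simps)
  moreover have "\<psi> (x * y) = of_nat d ^ q / of_nat d ^ p * \<psi> (y * x)" for y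
    using graded_KMS_mult[OF \<psi> bideg, of y] d by (simp add: field_simps)
  ultimately have "\<psi> (x * y) = \<psi> (y * (e (\<i> * of_real (ln (real d))) *\<^sub>C x))" for y
    by (simp add: mult_scaleC_right states_scaleC[OF graded_KMS_state[OF \<psi>]])
  with orbit show ?case by blast
next
  case (add x y)
  then obtain F G where F: "entire_orbit \<sigma> x F" "\<And>u. \<psi> (x * u) = \<psi> (u * F (\<i> * of_real (ln (real d))))"
    and G: "entire_orbit \<sigma> y G" "\<And>u. \<psi> (y * u) = \<psi> (u * G (\<i> * of_real (ln (real d))))" by blast
  have "entire_orbit \<sigma> (x + y) (\<lambda>z. F z + G z)"
    unfolding entire_orbit_def
  proof (intro conjI allI)
    fix z
    obtain D D' where "((\<lambda>w. inverse (w - z) *\<^sub>C (F w - F z)) \<longlongrightarrow> D) (at z)"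
      "((\<lambda>w. inverse (w - z) *\<^sub>C (G w - G z)) \<longlongrightarrow> D') (at z)"
      using F(1) G(1) unfolding entire_orbit_def by blast
    from tendsto_add[OF this]
    show "\<exists>D. ((\<lambda>w. inverse (w - z) *\<^sub>C (F w + G w - (F z + G z))) \<longlongrightarrow> D) (at z)"
      by (auto simp: algebra_simps simp flip: scaleC_add_right)
  qed (use F G in \<open>simp add: entire_orbit_def sigma_add\<close>)
  moreover have "\<psi> ((x + y) * u) =
      \<psi> (u * (F (\<i> * of_real (ln (real d))) + G (\<i> * of_real (ln (real d)))))" for u
    using states_add[OF graded_KMS_state[OF \<psi>]] by (simp add: distrib_left distrib_right F G)
  ultimately show ?case by blast
qed

text \<open>An element of bidegree (p, q) is its own spectral component of degree p - q, which gives
  one inclusion. For the other, the core serves as the dense subalgebra.\<close>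

lemma KMS_eq_graded_KMS: "KMS_states \<sigma> (ln (real d)) = graded_KMS"
proof (intro Set.equalityI subsetI)
  fix \<psi> assume \<psi>: "\<psi> \<in> KMS_states \<sigma> (ln (real d))"
  have "of_nat d ^ p * \<psi> (x * y) = of_nat d ^ q * \<psi> (y * x)" if x: "x \<in> bideg p q" for p q x y
    using KMS_spectral_mult[OF \<psi>, of "int p - int q" x y] d
    unfolding exp_ln_degree by (simp add: spectral_bideg[OF x] field_simps)
  then show "\<psi> \<in> graded_KMS" using \<psi> by (simp add: graded_KMS_def KMS_states_def)
next
  fix \<psi> assume \<psi>: "\<psi> \<in> graded_KMS"
  have "\<psi> (x * y) = \<psi> (y * F (\<i> * of_real (ln (real d))))"
    if x: "x \<in> core" and F: "entire_orbit \<sigma> x F" for x y F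
  proof -
    obtain G where G: "entire_orbit \<sigma> x G" "\<psi> (x * y) = \<psi> (y * G (\<i> * of_real (ln (real d))))"
      using graded_KMS_orbit[OF \<psi> x] by blast
    \<comment> \<open>The condition is required for every entire extension \<open>F\<close>, not
      only for the explicit \<open>G\<close>; their agreement under the functional is
      enough.\<close>
    have "\<psi> (y * F z) = \<psi> (y * G z)" for z
      by (rule holomorphic_eq_on_reals[where f = "\<lambda>z. \<psi> (y * F z)"])
        (use F G graded_KMS_state[OF \<psi>] in \<open>auto intro: entire_orbit_holomorphic simp: entire_orbit_def\<close>)
    then show ?thesis using G by simp
  qed
  moreover have "core \<subseteq> analytic_elements \<sigma>"
    using graded_KMS_orbit[OF \<psi>] by (auto simp: analytic_elements_def)
  ultimately show "\<psi> \<in> KMS_states \<sigma> (ln (real d))"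
    using graded_KMS_state[OF \<psi>] star_subalgebra_core closure_core sigma_core
    unfolding KMS_states_def by blast
qed

section \<open>Determination by the values on the coefficient algebra\<close>

lemma graded_KMS_transfer:
  assumes \<psi>: "\<psi> \<in> graded_KMS" shows "\<psi> (transfer x) = \<psi> x"
proof -
  note st = graded_KMS_state[OF \<psi>]
  note lin = bounded_linear.linear[OF states_bounded_linear[OF st]]
  have "\<psi> (star (S i) * x * S i) = of_nat d * \<psi> (S i * (star (S i) * x))" if "i \<in> {1..d}" for i
    using graded_KMS_mult[OF \<psi> bideg_S[OF that], of "star (S i) * x"] by simp
  then have "(\<Sum>i=1..d. \<psi> (star (S i) * x * S i)) = of_nat d * \<psi> (\<Sum>i=1..d. S i * (star (S i) * x))"
    by (simp add: linear_sum[OF lin] sum_distrib_left)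
  then show ?thesis using d
    by (simp add: transfer_def scaleR_scaleC states_scaleC[OF st] linear_sum[OF lin] sum_S_left)
qed

text \<open>The element a depends on x only, not on \<psi>. This uniformity is what makes evaluation
  at x a uniform limit of evaluations on A.\<close>

lemma graded_KMS_core:
  assumes "x \<in> core" shows "\<exists>a. \<forall>\<psi>\<in>graded_KMS. \<psi> x = \<psi> (\<iota> a)"
  using assms
proof induction
    case (bideg x p q)
    show ?case
    proof (cases "p = q")
      case True
      obtain a where a: "(transfer ^^ p) x = \<iota> a"
        using funpow_transfer_bideg[of x p] bideg True by blast
      have "\<psi> ((transfer ^^ n) x) = \<psi> x" if "\<psi> \<in> graded_KMS" for \<psi> n
        by (induction n) (simp_all add: graded_KMS_transfer[OF that])
      then show ?thesis using a by metis
    next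
      case False
      \<comment> \<open>With y = 1 the graded identity reads d^p \<psi>(x) = d^q \<psi>(x), so
        \<psi> vanishes off the diagonal.\<close>
      then have "of_nat d ^ p \<noteq> (of_nat d ^ q :: complex)"
        using d by (simp flip: of_nat_power)
      then have "\<psi> x = \<psi> (\<iota> 0)" if "\<psi> \<in> graded_KMS" for \<psi>
        using graded_KMS_mult[OF that bideg, of 1] states_scaleC[OF graded_KMS_state[OF that], of 0 0]
        by (simp add: iota_zero)
      then show ?thesis by blast
    qed
  next
    case (add x y)
    then obtain a b where ab: "\<forall>\<psi>\<in>graded_KMS. \<psi> x = \<psi> (\<iota> a)"
      "\<forall>\<psi>\<in>graded_KMS. \<psi> y = \<psi> (\<iota> b)" by blast
    have "\<psi> (x + y) = \<psi> (\<iota> (a + b))" if "\<psi> \<in> graded_KMS" for \<psi>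
      using ab[rule_format, OF that] states_add[OF graded_KMS_state[OF that]]
      by (simp add: iota_add)
    then show ?case by blast
qed

lemma graded_KMS_approx:
  assumes "e > 0" obtains a where "\<And>\<psi>. \<psi> \<in> graded_KMS \<Longrightarrow> cmod (\<psi> x - \<psi> (\<iota> a)) < e"
proof -
  obtain y where y: "y \<in> core" "norm (x - y) < e" using core_approx[OF assms] .
  obtain a where a: "\<forall>\<psi>\<in>graded_KMS. \<psi> y = \<psi> (\<iota> a)" using graded_KMS_core[OF y(1)] by blast
  show thesis
  proof (rule that)
    fix \<psi> assume \<psi>: "\<psi> \<in> graded_KMS"
    have "cmod (\<psi> x - \<psi> y) \<le> norm (x - y)"
      by (rule states_diff_le[OF _ _ graded_KMS_state[OF \<psi>]]) simp_all
    then show "cmod (\<psi> x - \<psi> (\<iota> a)) < e" using y(2) a[rule_format, OF \<psi>] by simp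
  qed
qed

lemma transfer_fixed: "x \<in> fixed \<Longrightarrow> transfer x \<in> fixed"
  unfolding transfer_def by (intro fixed_sub(5)[OF fixed_sum] S_fixed_S) assumption+

lemma AVT_fixed_transfer:
  assumes \<phi>: "\<phi> \<in> AVT_fixed d \<iota> S" and f: "f \<in> fixed" shows "\<phi> (transfer f) = \<phi> f"
proof -
  have st: "\<phi> \<in> states fixed" using \<phi> by (simp add: AVT_fixed_def tracial_states_def)
  \<comment> \<open>\<open>\<phi>\<close> is linear on \<open>fixed\<close> only, so summands are
    added one at a time, each partial sum being known to be fixed.\<close>
  have "\<phi> (\<Sum>i\<in>I. star (S i) * f * S i) = (\<Sum>i\<in>I. \<phi> (star (S i) * f * S i))"
    if "finite I" "I \<subseteq> {1..d}" for I
    using that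
  proof induction
    case empty
    show ?case using states_scaleC[OF st f, of 0] bideg_fixed[OF bideg_zero]
      states_scaleC[OF st, of 0 0] by simp
  next
    case (insert i I)
    then show ?case using f by (simp add: states_add[OF st] S_fixed_S fixed_sum subset_iff)
  qed
  moreover have "(\<Sum>i\<in>{1..d}. star (S i) * f * S i) \<in> fixed"
    by (intro fixed_sum S_fixed_S f)
  ultimately have "\<phi> (transfer f) = (1 / of_nat d) * (\<Sum>i=1..d. \<phi> (star (S i) * f * S i))"
    by (simp add: transfer_def scaleR_scaleC states_scaleC[OF st])
  with \<phi> f show ?thesis by (simp add: AVT_fixed_def)
qed

text \<open>For a diagonal g of level n, averaging gives \<phi>(g) = \<phi>(L^n g) with L^n g in A;
  again a is chosen before \<phi>.\<close>

lemma AVT_fixed_approx: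
  assumes f: "f \<in> fixed" and e: "e > 0"
  obtains a where "\<And>\<phi>. \<phi> \<in> AVT_fixed d \<iota> S \<Longrightarrow> cmod (\<phi> f - \<phi> (\<iota> a)) < e"
proof -
  obtain n g where g: "g \<in> bideg n n" "norm (f - g) < e" using fixed_approx[OF f e] .
  obtain a where a: "(transfer ^^ n) g = \<iota> a" using funpow_transfer_bideg[OF g(1)] by blast
  show thesis
  proof (rule that)
    fix \<phi> assume \<phi>: "\<phi> \<in> AVT_fixed d \<iota> S"
    have "(transfer ^^ k) g \<in> fixed \<and> \<phi> ((transfer ^^ k) g) = \<phi> g" for k
      by (induction k)
        (simp_all add: bideg_fixed[OF g(1)] AVT_fixed_transfer[OF \<phi>] transfer_fixed)
    then have "\<phi> g = \<phi> (\<iota> a)" using a by metis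
    moreover have "cmod (\<phi> f - \<phi> g) \<le> norm (f - g)"
      using \<phi> by (intro states_diff_le[OF fixed_sub(1) fixed_sub(4) _ f bideg_fixed[OF g(1)]])
        (simp_all add: AVT_fixed_def tracial_states_def)
    ultimately show "cmod (\<phi> f - \<phi> (\<iota> a)) < e" using g(2) by simp
  qed
qed

end

section \<open>Extending averaging traces\<close>

lemma contraction_extension:
  fixes f :: "'a::cstar_algebra \<Rightarrow> complex"
  assumes dense: "closure C = UNIV"
    and C_add: "\<And>x y. \<lbrakk>x \<in> C; y \<in> C\<rbrakk> \<Longrightarrow> x + y \<in> C"
    and C_scaleC: "\<And>c x. x \<in> C \<Longrightarrow> c *\<^sub>C x \<in> C"
    and add: "\<And>x y. \<lbrakk>x \<in> C; y \<in> C\<rbrakk> \<Longrightarrow> f (x + y) = f x + f y"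
    and scaleC: "\<And>c x. x \<in> C \<Longrightarrow> f (c *\<^sub>C x) = c * f x"
    and bound: "\<And>x. x \<in> C \<Longrightarrow> cmod (f x) \<le> norm x"
  obtains g where "\<And>x. x \<in> C \<Longrightarrow> g x = f x" "\<And>x y. g (x + y) = g x + g y"
    "\<And>c x. g (c *\<^sub>C x) = c * g x" "\<And>x. cmod (g x) \<le> norm x"
proof -
  have diff: "cmod (f x - f y) \<le> norm (x - y)" if "x \<in> C" "y \<in> C" for x y
  proof -
    have "x - y = x + (-1) *\<^sub>C y" by (simp add: scaleC.minus_left)
    moreover have "f (x + (-1) *\<^sub>C y) = f x - f y" "x + (-1) *\<^sub>C y \<in> C"
      using that by (simp_all add: add scaleC C_add C_scaleC del: scaleC.minus_left)
    ultimately show ?thesis using bound by metis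
  qed
  have "\<exists>p. (\<forall>n. p n \<in> C) \<and> p \<longlonglongrightarrow> x" for x
    using dense closure_sequential[of x C] by auto
  then obtain p where p: "\<And>x n. p x n \<in> C" "\<And>x. p x \<longlonglongrightarrow> x" by metis
  define g where "g x = lim (\<lambda>n. f (p x n))" for x
  have lim_p: "(\<lambda>n. f (p x n)) \<longlonglongrightarrow> g x" for x
  proof -
    have "Cauchy (\<lambda>n. f (p x n))"
    proof (rule CauchyI)
      fix e :: real assume "e > 0"
      with CauchyD[OF LIMSEQ_imp_Cauchy[OF p(2)]]
      obtain M where "\<forall>m\<ge>M. \<forall>n\<ge>M. norm (p x m - p x n) < e" by blast
      then show "\<exists>M. \<forall>m\<ge>M. \<forall>n\<ge>M. norm (f (p x m) - f (p x n)) < e"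
        by (meson diff p(1) le_less_trans)
    qed
    then show ?thesis unfolding g_def by (simp add: Cauchy_convergent_iff convergent_LIMSEQ_iff)
  qed
  \<comment> \<open>Independence of the approximating sequence. Additivity of \<open>g\<close> needs
    it, because the sum of the sequences chosen for x and y need not be the one chosen for x +
    y.\<close>
  have lim: "(\<lambda>n. f (q n)) \<longlonglongrightarrow> g x" if "\<And>n. q n \<in> C" "q \<longlonglongrightarrow> x" for q x
  proof -
    have "(\<lambda>n. norm (q n - p x n)) \<longlonglongrightarrow> 0"
      using tendsto_diff[OF that(2) p(2)[of x]] by (simp add: tendsto_norm_zero_iff)
    then have "(\<lambda>n. f (q n) - f (p x n)) \<longlonglongrightarrow> 0"
      by (rule Lim_null_comparison[rotated]) (simp add: diff that p)
    from tendsto_add[OF this lim_p[of x]] show ?thesis by simp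
  qed
  show thesis
  proof (rule that)
    show "g x = f x" if "x \<in> C" for x
      using LIMSEQ_unique[OF lim[of "\<lambda>n. x" x]] that by simp
    show "g (x + y) = g x + g y" for x y
    proof (rule LIMSEQ_unique)
      show "(\<lambda>n. f (p x n + p y n)) \<longlonglongrightarrow> g (x + y)"
        by (intro lim C_add p tendsto_add)
      show "(\<lambda>n. f (p x n + p y n)) \<longlonglongrightarrow> g x + g y"
        using tendsto_add[OF lim_p[of x] lim_p[of y]] by (simp add: add p)
    qed
    show "g (c *\<^sub>C x) = c * g x" for c x
    proof (rule LIMSEQ_unique)
      show "(\<lambda>n. f (c *\<^sub>C p x n)) \<longlonglongrightarrow> g (c *\<^sub>C x)"
        by (intro lim C_scaleC p scaleC.tendsto tendsto_const)
      show "(\<lambda>n. f (c *\<^sub>C p x n)) \<longlonglongrightarrow> c * g x"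
        using tendsto_mult[OF tendsto_const[of c] lim_p[of x]] by (simp add: scaleC p)
    qed
    show "cmod (g x) \<le> norm x" for x
      by (rule tendsto_le[OF _ tendsto_norm[OF p(2)] tendsto_norm[OF lim_p]]) (auto simp: bound p)
  qed
qed

context cuntz_pimsner_algebra
begin

text \<open>Prepares positivity on the core: in the expansion of \<open>star x * x\<close> the mixed
  terms have nonzero degree and drop out.\<close>

lemma core_homogeneous_sum:
  assumes "x \<in> core"
  obtains f J where "finite J" "\<And>m. f m \<in> homog m" "x = sum f J"
proof -
  \<comment> \<open>\<open>f\<close> is also required to vanish outside \<open>J\<close>, so that
    two decompositions can be added over the union of their index sets.\<close>
  have "\<exists>f J. finite J \<and> (\<forall>m. f m \<in> homog m) \<and> (\<forall>m. m \<notin> J \<longrightarrow> f m = 0) \<and> x = sum f J"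
    using assms
  proof induction
    case (bideg x p q)
    then show ?case
      by (intro exI[of _ "\<lambda>m. if m = int p - int q then x else 0"] exI[of _ "{int p - int q}"])
        (auto simp: homog_zero dest: homogI)
  next
    case (add x y)
    then obtain f J g K where f: "finite J" "\<And>m. f m \<in> homog m" "\<And>m. m \<notin> J \<Longrightarrow> f m = 0" "x = sum f J"
      and g: "finite K" "\<And>m. g m \<in> homog m" "\<And>m. m \<notin> K \<Longrightarrow> g m = 0" "y = sum g K" by blast
    have "x = sum f (J \<union> K)" "y = sum g (J \<union> K)"
      using f g by (auto intro!: sum.mono_neutral_left)
    then show ?case using f g
      by (intro exI[of _ "\<lambda>m. f m + g m"] exI[of _ "J \<union> K"]) (auto simp: sum.distrib homog_add)
  qed
  then show thesis using that by blast
qed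

end

section \<open>The functional defined by an averaging trace\<close>

locale averaging_trace = cuntz_pimsner_algebra d \<alpha> \<iota> S
  for d and \<alpha> :: "nat \<Rightarrow> 'a::cstar_algebra \<Rightarrow> 'a" and \<iota> :: "'a \<Rightarrow> 'b::cstar_algebra" and S +
  fixes \<tau> :: "'a \<Rightarrow> complex"
  assumes averaging: "\<tau> \<in> AVT_coeff d \<alpha>"
begin

lemma tau_state: "\<tau> \<in> states UNIV"
  and tau_trace: "\<tau> (x * y) = \<tau> (y * x)"
  and tau_average: "\<tau> a = (1 / of_nat d) * (\<Sum>i=1..d. \<tau> (\<alpha> i a))"
  using averaging unfolding AVT_coeff_def tracial_states_def by blast+

lemmas tau_add = states_add[OF tau_state UNIV_I UNIV_I]
  and tau_scaleC = states_scaleC[OF tau_state UNIV_I]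

text \<open>Meaningful on \<open>bideg n n\<close>, where the n-fold transfer lands in the image of
  \<open>\<iota>\<close>.\<close>

definition level_trace :: "nat \<Rightarrow> 'b \<Rightarrow> complex" where
  "level_trace n x = \<tau> (inv_into UNIV \<iota> ((transfer ^^ n) x))"

lemma level_trace_Suc_transfer: "level_trace (Suc n) x = level_trace n (transfer x)"
  by (simp add: level_trace_def funpow_Suc_right del: funpow.simps)

text \<open>The averaging condition enters here, as invariance of \<tau> under L on A.\<close>

lemma level_trace_Suc:
  assumes "x \<in> bideg n n" shows "level_trace (Suc n) x = level_trace n x"
proof -
  obtain a where a: "(transfer ^^ n) x = \<iota> a" using funpow_transfer_bideg[OF assms] by blast
  have "\<tau> (\<Sum>i=1..d. \<alpha> i a) = (\<Sum>i=1..d. \<tau> (\<alpha> i a))"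
    by (rule linear_sum[OF bounded_linear.linear[OF states_bounded_linear[OF tau_state]]])
  then show ?thesis
    by (simp add: level_trace_def a transfer_iota scaleR_scaleC tau_scaleC tau_average[of a])
qed

lemma level_trace_raise: "x \<in> bideg n n \<Longrightarrow> level_trace (n + k) x = level_trace n x"
  by (induction k) (simp_all add: level_trace_Suc bideg_raise)

lemma level_trace_cong:
  assumes "x \<in> bideg m m" "x \<in> bideg n n" shows "level_trace m x = level_trace n x"
  using level_trace_raise[OF assms(1), of n] level_trace_raise[OF assms(2), of m]
  by (simp add: add.commute)

lemma level_trace_add:
  assumes "x \<in> bideg n n" "y \<in> bideg n n"
  shows "level_trace n (x + y) = level_trace n x + level_trace n y"
proof -
  obtain a b where "(transfer ^^ n) x = \<iota> a" "(transfer ^^ n) y = \<iota> b"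
    using assms funpow_transfer_bideg by blast
  then show ?thesis by (simp add: level_trace_def funpow_transfer_add tau_add flip: iota_add)
qed

lemma level_trace_scaleC:
  assumes "x \<in> bideg n n" shows "level_trace n (c *\<^sub>C x) = c * level_trace n x"
proof -
  obtain a where "(transfer ^^ n) x = \<iota> a" using assms funpow_transfer_bideg by blast
  then show ?thesis
    by (simp add: level_trace_def funpow_transfer_scaleC tau_scaleC flip: iota_scaleC)
qed

lemma norm_level_trace_le:
  assumes "x \<in> bideg n n" shows "cmod (level_trace n x) \<le> norm x"
proof -
  obtain a where a: "(transfer ^^ n) x = \<iota> a" using assms funpow_transfer_bideg by blast
  then have "cmod (level_trace n x) \<le> norm (\<iota> a)"
    by (simp add: level_trace_def iota_norm states_norm_le[OF tau_state])
  then show ?thesis using norm_funpow_transfer_le[of n x] a by simp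
qed

text \<open>The level is not unique; \<open>level_trace_cong\<close> makes the choice irrelevant, so
  that additivity can be checked at a common level.\<close>

definition core_trace :: "'b \<Rightarrow> complex" where
  "core_trace x = level_trace (SOME n. spectral 0 x \<in> bideg n n) (spectral 0 x)"

lemma core_trace_eq:
  assumes "spectral 0 x \<in> bideg n n" shows "core_trace x = level_trace n (spectral 0 x)"
  unfolding core_trace_def by (rule level_trace_cong[OF someI[of "\<lambda>n. spectral 0 x \<in> bideg n n", OF assms] assms])

lemma core_trace_diag: "x \<in> bideg n n \<Longrightarrow> core_trace x = level_trace n x"
  using core_trace_eq[of x n] by (simp add: spectral_bideg)

lemma core_trace_offdiag: "\<lbrakk>x \<in> bideg p q; p \<noteq> q\<rbrakk> \<Longrightarrow> core_trace x = 0"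
  using core_trace_eq[of x 0] bideg_zero[of 0 0] level_trace_scaleC[OF bideg_zero[of 0 0], of 0]
  by (simp add: spectral_bideg)

lemma core_trace_add:
  assumes "x \<in> core" "y \<in> core"
  shows "core_trace (x + y) = core_trace x + core_trace y"
proof -
  obtain m n where "spectral 0 x \<in> bideg m m" "spectral 0 y \<in> bideg n n"
    using assms spectral_core by metis
  then have "spectral 0 x \<in> bideg (m + n) (m + n)" "spectral 0 y \<in> bideg (m + n) (m + n)"
    using bideg_raise[of "spectral 0 y" n n m] by (auto simp: add.commute intro: bideg_raise)
  then show ?thesis
    by (simp add: core_trace_eq[of _ "m + n"] spectral_add bideg_add level_trace_add)
qed

lemma core_trace_scaleC:
  assumes "x \<in> core" shows "core_trace (c *\<^sub>C x) = c * core_trace x"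
proof -
  obtain n where "spectral 0 x \<in> bideg n n" using assms spectral_core by metis
  then show ?thesis
    by (simp add: core_trace_eq[of _ n] spectral_scaleC bideg_scaleC level_trace_scaleC)
qed

lemma norm_core_trace_le:
  assumes "x \<in> core" shows "cmod (core_trace x) \<le> norm x"
proof -
  obtain n where n: "spectral 0 x \<in> bideg n n" using assms spectral_core by metis
  show ?thesis
    using norm_level_trace_le[OF n] norm_spectral_le[of 0 x] by (simp add: core_trace_eq[OF n])
qed

text \<open>After the extension by continuity, the remaining properties are pulled back to A by
  stripping generators: the graded identity to the trace property of \<tau>, positivity to that of
  \<tau>.\<close>

lemma graded_KMS_extension:
  obtains \<psi> where "\<psi> \<in> graded_KMS" "\<And>a. \<psi> (\<iota> a) = \<tau> a"
proof -
  have sub: "\<And>x y. \<lbrakk>x \<in> core; y \<in> core\<rbrakk> \<Longrightarrow> x + y \<in> core" "\<And>c x. x \<in> core \<Longrightarrow> c *\<^sub>C x \<in> core"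
    using star_subalgebra_core by (auto simp: star_subalgebra_def)
  obtain \<psi> where core: "\<And>x. x \<in> core \<Longrightarrow> \<psi> x = core_trace x"
    and add: "\<And>x y. \<psi> (x + y) = \<psi> x + \<psi> y" and scaleC: "\<And>c x. \<psi> (c *\<^sub>C x) = c * \<psi> x"
    and bound: "\<And>x. cmod (\<psi> x) \<le> norm x"
    using contraction_extension[OF closure_core sub core_trace_add core_trace_scaleC norm_core_trace_le]
    by blast
  have lin: "bounded_linear \<psi>"
    by (rule bounded_linear_intro[of _ 1])
      (simp_all add: add scaleC bound scaleR_scaleC scaleR_conv_of_real)
  note psi_sum = linear_sum[OF bounded_linear.linear[OF lin]]
  have diag: "\<psi> x = level_trace n x" if "x \<in> bideg n n" for n x
    using that core[OF core.bideg] core_trace_diag by metis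
  have offdiag: "\<psi> x = 0" if "x \<in> homog m" "m \<noteq> 0" for m x
    using that core[OF core.bideg] core_trace_offdiag by (auto simp: homog_def)
  have iota: "\<psi> (\<iota> a) = \<tau> a" for a
    by (simp add: diag[OF bideg_iota] level_trace_def)
  \<comment> \<open>Level n + 1 at x is level n at L x, so \<psi> is invariant under L on the
    diagonal.\<close>
  have transfer: "(\<Sum>i=1..d. \<psi> (star (S i) * x * S i)) = of_nat d * \<psi> x"
    if "x \<in> bideg (Suc n) (Suc n)" for n x
  proof -
    have "\<psi> x = \<psi> (transfer x)"
      using diag[OF that] diag[OF transfer_bideg[OF that]] by (simp add: level_trace_Suc_transfer)
    then show ?thesis
      using d by (simp add: transfer_def scaleR_scaleC scaleC psi_sum)
  qed
  \<comment> \<open>A left generator of x is moved across by \<open>transfer\<close>, which costs a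
    factor d, and is absorbed between y and x because the S_i S_i^* sum to 1. For right generators
    the two moves are interchanged.\<close>
  have opposite: "of_nat d ^ p * \<psi> (x * y) = of_nat d ^ q * \<psi> (y * x)"
    if "x \<in> bideg p q" "y \<in> bideg q p" for p q x y
    using that
  proof (induction p q arbitrary: x y rule: bideg_induct)
    case 1
    then show ?case by (auto simp: iota tau_trace simp flip: iota_mult)
  next
    case (2 p)
    have "of_nat d ^ Suc p * \<psi> (x * y) =
        of_nat d ^ p * (\<Sum>i=1..d. \<psi> (star (S i) * (x * y) * S i))"
      using transfer[OF bideg_mult[OF 2(2,3)]] by simp
    also have "\<dots> = (\<Sum>i=1..d. of_nat d ^ p * \<psi> ((star (S i) * x) * (y * S i)))"
      by (simp add: sum_distrib_left mult.assoc)
    also have "\<dots> = (\<Sum>i=1..d. of_nat d ^ 0 * \<psi> ((y * S i) * (star (S i) * x)))"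
      using 2(2,3) by (intro sum.cong refl 2(1)) simp_all
    also have "\<dots> = \<psi> (y * x)"
      by (simp only: power_0 mult_1 sum_S_mid flip: psi_sum)
    finally show ?case by simp
  next
    case (3 p q)
    have "of_nat d ^ p * \<psi> (x * y) = (\<Sum>i=1..d. of_nat d ^ p * \<psi> ((x * S i) * (star (S i) * y)))"
      by (simp only: sum_S_mid flip: psi_sum sum_distrib_left)
    also have "\<dots> = (\<Sum>i=1..d. of_nat d ^ q * \<psi> ((star (S i) * y) * (x * S i)))"
      using 3(2,3) by (intro sum.cong refl 3(1)) (simp_all add: bideg_Suc_left)
    also have "\<dots> = of_nat d ^ q * (\<Sum>i=1..d. \<psi> (star (S i) * (y * x) * S i))"
      by (simp add: sum_distrib_left mult.assoc)
    also have "\<dots> = of_nat d ^ Suc q * \<psi> (y * x)"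
      using transfer[OF bideg_mult[OF 3(3,2)]] by simp
    finally show ?case .
  qed
  have graded: "of_nat d ^ p * \<psi> (x * y) = of_nat d ^ q * \<psi> (y * x)" if x: "x \<in> bideg p q" for p q x y
  proof -
    have "of_nat d ^ p * \<psi> (x * y) = of_nat d ^ q * \<psi> (y * x)" if "y \<in> core" for y
      using that
    proof induction
      case (bideg y r s)
      show ?case
      \<comment> \<open>In total degree 0, raising x by s and y by p makes their bidegrees opposite,
        and the common factor d^s cancels. In any other degree \<psi> vanishes on both
        products.\<close>
      proof (cases "p + r = q + s")
        case True
        then have "y \<in> bideg (q + s) (p + s)"
          using bideg_raise[OF bideg, of p] by (simp add: add.commute)
        then have "of_nat d ^ (p + s) * \<psi> (x * y) = of_nat d ^ (q + s) * \<psi> (y * x)"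
          by (intro opposite bideg_raise[OF x])
        then show ?thesis using d by (simp add: power_add)
      next
        case False
        have "x * y \<in> homog (int p - int q + (int r - int s))" "y * x \<in> homog (int r - int s + (int p - int q))"
          by (intro homog_mult homogI x bideg)+
        then show ?thesis using False by (simp add: offdiag)
      qed
    qed (simp add: distrib_left distrib_right add)
    then have "closure core \<subseteq> {y. of_nat d ^ p * \<psi> (x * y) = of_nat d ^ q * \<psi> (y * x)}"
      by (intro closure_minimal closed_Collect_eq continuous_intros
          bounded_linear.continuous_on[OF lin]) auto
    then show ?thesis by (auto simp: closure_core)
  qed
  have sum_nonneg: "sum f I \<in> nonneg_Reals" if "\<And>i. i \<in> I \<Longrightarrow> f i \<in> nonneg_Reals"
    for f :: "'i \<Rightarrow> complex" and I
    using that by (induction I rule: infinite_finite_induct) auto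
  \<comment> \<open>Left generators split \<open>star x * x\<close> into a sum of such squares;
    right generators do so after multiplication by d, which the factor 1 / d undoes.\<close>
  have pos_bideg: "\<psi> (star x * x) \<in> nonneg_Reals" if "x \<in> bideg p q" for p q x
    using that
  proof (induction p q arbitrary: x rule: bideg_induct)
    case 1
    then show ?case
      using states_pos[OF tau_state] by (auto simp: iota simp flip: iota_star iota_mult)
  next
    case (2 p)
    have "\<psi> (star x * x) = (\<Sum>i=1..d. \<psi> (star (star (S i) * x) * (star (S i) * x)))"
      by (simp only: star_mult star_star sum_S_mid flip: psi_sum)
    then show ?case using 2 by (auto intro!: sum_nonneg)
  next
    case (3 p q)
    have "of_nat d * \<psi> (star x * x) = (\<Sum>i=1..d. \<psi> (star (x * S i) * (x * S i)))"
      using transfer[OF bideg_mult[OF bideg_star[OF 3(2)] 3(2)]] by (simp add: star_mult mult.assoc)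
    also have "\<dots> \<in> nonneg_Reals" using 3 by (intro sum_nonneg) simp
    finally have "complex_of_real (1 / real d) * (of_nat d * \<psi> (star x * x)) \<in> nonneg_Reals"
      by (rule nonneg_Reals_mult_I[rotated]) simp
    then show ?case using d by simp
  qed
  have pos_core: "\<psi> (star x * x) \<in> nonneg_Reals" if x: "x \<in> core" for x
  proof -
    obtain f J where f: "finite J" "\<And>m. f m \<in> homog m" "x = sum f J"
      using core_homogeneous_sum[OF x] by metis
    have "\<psi> (star x * x) = (\<Sum>m\<in>J. \<Sum>n\<in>J. \<psi> (star (f m) * f n))"
      by (simp add: f(3) star_sum sum_product psi_sum)
    also have "\<dots> = (\<Sum>m\<in>J. \<Sum>n\<in>J. if m = n then \<psi> (star (f n) * f n) else 0)"
      using offdiag[OF homog_mult[OF homog_star[OF f(2)] f(2)]] by (intro sum.cong refl) auto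
    also have "\<dots> = (\<Sum>n\<in>J. \<psi> (star (f n) * f n))"
      using f(1) by simp
    finally have "\<psi> (star x * x) = (\<Sum>n\<in>J. \<psi> (star (f n) * f n))" .
    moreover have "\<psi> (star (f n) * f n) \<in> nonneg_Reals" for n
      using f(2)[of n] pos_bideg by (auto simp: homog_def)
    ultimately show ?thesis by (simp add: sum_nonneg)
  qed
  have pos: "\<psi> (star x * x) \<in> nonneg_Reals" for x
  proof -
    have "x \<in> closure core" by (simp add: closure_core)
    then obtain p where p: "\<And>n. p n \<in> core" "p \<longlonglongrightarrow> x" unfolding closure_sequential by blast
    have lim: "(\<lambda>n. \<psi> (star (p n) * p n)) \<longlonglongrightarrow> \<psi> (star x * x)"
      by (rule bounded_linear.tendsto[OF lin tendsto_mult[OF star_tendsto[OF p(2)] p(2)]])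
    show ?thesis
      by (rule closed_sequentially[OF closed_nonneg_Reals_complex pos_core[OF p(1)] lim])
  qed
  have "\<psi> 1 = 1" using iota[of 1] states_one[OF tau_state] by (simp add: iota_one)
  then have "\<psi> \<in> graded_KMS"
    by (simp add: graded_KMS_def states_def add scaleC bound pos graded del: bideg.simps)
  then show thesis using that iota by blast
qed

end

section \<open>Affine homeomorphisms by restriction\<close>

lemma topspace_weak_star: "K \<subseteq> extensional M \<Longrightarrow> topspace (weak_star_topology M K) = K"
  by (auto simp: weak_star_topology_def PiE_def)

lemma weak_star_evaluation:
  "x \<in> M \<Longrightarrow> continuous_map (weak_star_topology M K) euclidean (\<lambda>\<phi>. \<phi> x)"
  unfolding weak_star_topology_def
  by (intro continuous_map_from_subtopology continuous_map_product_projection)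

lemma continuous_map_into_weak_star:
  assumes "K \<subseteq> extensional M" "h \<in> topspace X \<rightarrow> K"
    and "\<And>x. x \<in> M \<Longrightarrow> continuous_map X euclidean (\<lambda>\<phi>. h \<phi> x)"
  shows "continuous_map X (weak_star_topology M K) h"
  using assms unfolding weak_star_topology_def continuous_map_in_subtopology continuous_map_componentwise
  by auto

text \<open>The inverse of the restriction map \<open>\<phi> \<mapsto> \<phi> \<circ> j\<close> is continuous, with no appeal to compactness,
  because evaluation at \<open>x\<close> is a uniform limit on \<open>K\<close> of evaluations at points \<open>j y\<close>.\<close>

lemma affinely_weak_star_homeomorphic_by_restriction:
  assumes KM: "K \<subseteq> extensional M" and LN: "L \<subseteq> extensional N"
    and j: "\<And>y. y \<in> N \<Longrightarrow> j y \<in> M"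
    and into: "\<And>\<phi>. \<phi> \<in> K \<Longrightarrow> (\<lambda>y\<in>N. \<phi> (j y)) \<in> L"
    and onto: "\<And>\<tau>. \<tau> \<in> L \<Longrightarrow> \<exists>\<phi>\<in>K. \<forall>y\<in>N. \<phi> (j y) = \<tau> y"
    and approx: "\<And>x e. \<lbrakk>x \<in> M; e > 0\<rbrakk> \<Longrightarrow> \<exists>y\<in>N. \<forall>\<phi>\<in>K. cmod (\<phi> x - \<phi> (j y)) < e"
    and conv: "\<And>\<tau> \<tau>' t. \<lbrakk>\<tau> \<in> L; \<tau>' \<in> L; t \<in> {0..1}\<rbrakk> \<Longrightarrow>
      (\<lambda>y\<in>N. of_real t * \<tau> y + of_real (1 - t) * \<tau>' y) \<in> L"
  shows "affinely_weak_star_homeomorphic N L M K"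
proof -
  obtain h where h: "\<And>\<tau>. \<tau> \<in> L \<Longrightarrow> h \<tau> \<in> K" "\<And>\<tau> y. \<lbrakk>\<tau> \<in> L; y \<in> N\<rbrakk> \<Longrightarrow> h \<tau> (j y) = \<tau> y"
    using onto by metis
  define res where "res \<phi> = (\<lambda>y\<in>N. \<phi> (j y))" for \<phi> :: "'a \<Rightarrow> complex"
  have res: "res \<phi> \<in> L" if "\<phi> \<in> K" for \<phi> using into[OF that] by (simp add: res_def)
  have res_h: "res (h \<tau>) = \<tau>" if "\<tau> \<in> L" for \<tau>
    using LN that h(2)[OF that] by (intro extensionalityI[of _ N]) (auto simp: res_def)
  \<comment> \<open>Each of the two functionals is within half of the supposed gap of its value at
    the same point \<open>j y\<close>, where they agree.\<close>
  have inj: "\<phi> x = \<psi> x" if "\<phi> \<in> K" "\<psi> \<in> K" "res \<phi> = res \<psi>" "x \<in> M" for \<phi> \<psi> x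
  proof (rule ccontr)
    assume "\<phi> x \<noteq> \<psi> x"
    then have "cmod (\<phi> x - \<psi> x) / 2 > 0" by simp
    from approx[OF that(4) this] obtain y where y: "y \<in> N"
      "\<And>\<phi>'. \<phi>' \<in> K \<Longrightarrow> cmod (\<phi>' x - \<phi>' (j y)) < cmod (\<phi> x - \<psi> x) / 2" by blast
    have "\<phi> (j y) = \<psi> (j y)" using fun_cong[OF that(3), of y] y(1) by (simp add: res_def)
    then show False
      using y(2)[OF that(1)] y(2)[OF that(2)] norm_triangle_ineq4[of "\<phi> x - \<phi> (j y)" "\<psi> x - \<phi> (j y)"]
      by simp
  qed
  have h_res: "h (res \<phi>) = \<phi>" if "\<phi> \<in> K" for \<phi>
    using KM that h(1)[OF res[OF that]] res_h[OF res[OF that]]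
    by (intro extensionalityI[of _ M]) (auto intro: inj)
  have top: "topspace (weak_star_topology M K) = K" "topspace (weak_star_topology N L) = L"
    by (simp_all add: topspace_weak_star KM LN)
  have cont_res: "continuous_map (weak_star_topology M K) (weak_star_topology N L) res"
    by (rule continuous_map_into_weak_star[OF LN])
      (auto simp: top res, simp add: res_def weak_star_evaluation j)
  have cont_h: "continuous_map (weak_star_topology N L) (weak_star_topology M K) h"
  proof (rule continuous_map_into_weak_star[OF KM])
    fix x assume x: "x \<in> M"
    show "continuous_map (weak_star_topology N L) euclidean (\<lambda>\<tau>. h \<tau> x)"
      unfolding continuous_map_def
    proof (intro conjI allI impI)
      fix U :: "complex set" assume U: "openin euclidean U"
      show "openin (weak_star_topology N L) {\<tau> \<in> topspace (weak_star_topology N L). h \<tau> x \<in> U}"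
        unfolding top
      proof (subst openin_subopen, safe)
        fix \<tau> assume \<tau>: "\<tau> \<in> L" "h \<tau> x \<in> U"
        obtain e where e: "e > 0" "\<And>z. cmod (z - h \<tau> x) < e \<Longrightarrow> z \<in> U"
          using U \<tau>(2) by (auto simp: open_dist dist_norm)
        obtain y where y: "y \<in> N" "\<And>\<phi>. \<phi> \<in> K \<Longrightarrow> cmod (\<phi> x - \<phi> (j y)) < e / 3"
          using approx[OF x, of "e / 3"] e(1) by auto
        let ?V = "{\<tau>' \<in> topspace (weak_star_topology N L). \<tau>' y \<in> ball (\<tau> y) (e / 3)}"
        have "openin (weak_star_topology N L) ?V"
          by (rule openin_continuous_map_preimage[OF weak_star_evaluation[OF y(1)]]) simp
        moreover have "\<tau> \<in> ?V" using \<tau> e by (simp add: top)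
        moreover have "?V \<subseteq> {\<tau> \<in> L. h \<tau> x \<in> U}"
        proof safe
          fix \<tau>' assume V: "\<tau>' \<in> topspace (weak_star_topology N L)" "\<tau>' y \<in> ball (\<tau> y) (e / 3)"
          then show "\<tau>' \<in> L" by (simp add: top)
          have "cmod (h \<tau>' x - \<tau>' y) < e / 3" "cmod (h \<tau> x - \<tau> y) < e / 3"
            using y(2)[OF h(1)] h(2)[OF _ y(1)] \<tau>(1) \<open>\<tau>' \<in> L\<close> by metis+
          moreover have "cmod (\<tau>' y - \<tau> y) < e / 3" using V by (simp add: dist_norm norm_minus_commute)
          moreover have "cmod (h \<tau>' x - h \<tau> x) \<le>
              cmod (h \<tau>' x - \<tau>' y) + cmod (\<tau>' y - \<tau> y) + cmod (h \<tau> x - \<tau> y)"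
            using norm_triangle_ineq4[of "h \<tau>' x - \<tau> y" "h \<tau> x - \<tau> y"]
              norm_triangle_ineq[of "h \<tau>' x - \<tau>' y" "\<tau>' y - \<tau> y"] by simp
          ultimately show "h \<tau>' x \<in> U" by (intro e(2)) linarith
        qed
        ultimately show "\<exists>V. openin (weak_star_topology N L) V \<and> \<tau> \<in> V \<and> V \<subseteq> {\<tau> \<in> L. h \<tau> x \<in> U}"
          by blast
      qed
    qed simp
  qed (simp add: top h(1))
  have "homeomorphic_map (weak_star_topology N L) (weak_star_topology M K) h"
    unfolding homeomorphic_map_maps homeomorphic_maps_def
    using cont_h cont_res h_res res_h by (auto simp: top)
  moreover have "affine_on_functionals N L M h"
    unfolding affine_on_functionals_def
  proof (intro ballI)
    fix \<tau> \<tau>' and t :: real assume *: "\<tau> \<in> L" "\<tau>' \<in> L" "t \<in> {0..1}"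
    define \<rho> where "\<rho> = (\<lambda>y\<in>N. of_real t * \<tau> y + of_real (1 - t) * \<tau>' y)"
    \<comment> \<open>\<open>\<phi>\<close> is not known to belong to \<open>K\<close>, so
      injectivity of the restriction does not apply to it. Instead one y serves for
      \<open>h \<rho>\<close>, \<open>h \<tau>\<close> and \<open>h \<tau>'\<close> at once, and the
      error of \<open>\<phi>\<close> is a convex combination of the last two errors.\<close>
    define \<phi> where "\<phi> = (\<lambda>x\<in>M. of_real t * h \<tau> x + of_real (1 - t) * h \<tau>' x)"
    have \<rho>: "\<rho> \<in> L" unfolding \<rho>_def by (rule conv[OF *])
    have "h \<rho> x = \<phi> x" if x: "x \<in> M" for x
    proof (rule ccontr)
      assume ne: "h \<rho> x \<noteq> \<phi> x"
      define e where "e = cmod (h \<rho> x - \<phi> x) / 2"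
      have e: "e > 0" using ne by (simp add: e_def)
      obtain y where y: "y \<in> N" "\<And>\<phi>. \<phi> \<in> K \<Longrightarrow> cmod (\<phi> x - \<phi> (j y)) < e"
        using approx[OF x e] by blast
      have le: "cmod (h \<rho> x - \<rho> y) < e" "cmod (h \<tau> x - \<tau> y) < e" "cmod (h \<tau>' x - \<tau>' y) < e"
        using y(2)[OF h(1)] h(2)[OF _ y(1)] * \<rho> by metis+
      have "\<phi> x - \<rho> y = of_real t * (h \<tau> x - \<tau> y) + of_real (1 - t) * (h \<tau>' x - \<tau>' y)"
        using x y(1) by (simp add: \<phi>_def \<rho>_def algebra_simps)
      also have "cmod \<dots> \<le> t * cmod (h \<tau> x - \<tau> y) + (1 - t) * cmod (h \<tau>' x - \<tau>' y)"
        using *(3) by (intro norm_triangle_mono) (simp_all add: norm_mult del: of_real_diff)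
      also have "\<dots> \<le> t * e + (1 - t) * e"
        using le *(3) by (intro add_mono mult_left_mono) auto
      finally have "cmod (\<phi> x - \<rho> y) \<le> e" by (simp add: algebra_simps)
      then have "cmod (h \<rho> x - \<phi> x) < 2 * e"
        using le(1) norm_triangle_ineq4[of "h \<rho> x - \<rho> y" "\<phi> x - \<rho> y"] by simp
      then show False by (simp add: e_def)
    qed
    then have "h \<rho> = \<phi>"
      using KM h(1)[OF \<rho>] by (intro extensionalityI[of _ M]) (auto simp: \<phi>_def)
    then show "h (\<lambda>x\<in>N. of_real t * \<tau> x + of_real (1 - t) * \<tau>' x) =
       (\<lambda>y\<in>M. of_real t * h \<tau> y + of_real (1 - t) * h \<tau>' y)"
      by (simp add: \<rho>_def \<phi>_def)
  qed
  ultimately show ?thesis unfolding affinely_weak_star_homeomorphic_def by blast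
qed

section \<open>Convexity of the sets of averaging traces\<close>

lemma tracial_states_convex:
  assumes M: "1 \<in> M" "\<And>x y. \<lbrakk>x \<in> M; y \<in> M\<rbrakk> \<Longrightarrow> x + y \<in> M \<and> x * y \<in> M"
      "\<And>x c. x \<in> M \<Longrightarrow> c *\<^sub>C x \<in> M \<and> star x \<in> M"
    and \<phi>: "\<phi> \<in> tracial_states M" "\<psi> \<in> tracial_states M" and t: "t \<in> {0..1}"
  shows "(\<lambda>x\<in>M. of_real t * \<phi> x + of_real (1 - t) * \<psi> x) \<in> tracial_states M"
proof -
  have st: "\<phi> \<in> states M" "\<psi> \<in> states M" using \<phi> by (simp_all add: tracial_states_def)
  have pos: "of_real t * \<phi> (star x * x) + of_real (1 - t) * \<psi> (star x * x) \<in> nonneg_Reals"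
    if "x \<in> M" for x
    using states_pos[OF st(1) that] states_pos[OF st(2) that] t
    by (intro nonneg_Reals_add_I nonneg_Reals_mult_I) (auto simp del: of_real_diff)
  have bound: "cmod (of_real t * \<phi> x + of_real (1 - t) * \<psi> x) \<le> norm x" if "x \<in> M" for x
  proof -
    have "cmod (of_real t * \<phi> x + of_real (1 - t) * \<psi> x) \<le> t * cmod (\<phi> x) + (1 - t) * cmod (\<psi> x)"
      using t by (intro norm_triangle_mono) (simp_all add: norm_mult del: of_real_diff)
    also have "\<dots> \<le> t * norm x + (1 - t) * norm x"
      using t states_norm_le[OF st(1) that] states_norm_le[OF st(2) that]
      by (intro add_mono mult_left_mono) auto
    finally show ?thesis by (simp add: algebra_simps)
  qed
  have trace: "\<phi> (x * y) = \<phi> (y * x)" "\<psi> (x * y) = \<psi> (y * x)" if "x \<in> M" "y \<in> M" for x y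
    using \<phi> that by (auto simp: tracial_states_def)
  have "(\<lambda>x\<in>M. of_real t * \<phi> x + of_real (1 - t) * \<psi> x) \<in> states M"
    unfolding states_def using M
    by (auto simp: pos bound states_add[OF st(1)] states_add[OF st(2)]
        states_scaleC[OF st(1)] states_scaleC[OF st(2)] states_one[OF st(1)] states_one[OF st(2)]
        simp del: of_real_diff intro: restrict_extensional) (simp_all add: algebra_simps)
  then show ?thesis using M by (simp add: tracial_states_def trace)
qed

lemma AVT_coeff_convex:
  assumes "\<tau> \<in> AVT_coeff d \<alpha>" "\<tau>' \<in> AVT_coeff d \<alpha>" "t \<in> {0..1}"
  shows "(\<lambda>x\<in>UNIV. of_real t * \<tau> x + of_real (1 - t) * \<tau>' x) \<in> AVT_coeff d \<alpha>"
proof -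
  have av: "\<tau> a = (1 / of_nat d) * (\<Sum>i=1..d. \<tau> (\<alpha> i a))" "\<tau>' a = (1 / of_nat d) * (\<Sum>i=1..d. \<tau>' (\<alpha> i a))" for a
    using assms unfolding AVT_coeff_def by blast+
  have "(\<lambda>x\<in>UNIV. of_real t * \<tau> x + of_real (1 - t) * \<tau>' x) \<in> tracial_states UNIV"
    using assms unfolding AVT_coeff_def by (intro tracial_states_convex) blast+
  moreover have "of_real t * \<tau> a + of_real (1 - t) * \<tau>' a =
      (1 / of_nat d) * (\<Sum>i=1..d. of_real t * \<tau> (\<alpha> i a) + of_real (1 - t) * \<tau>' (\<alpha> i a))" for a
    unfolding av(1)[of a] av(2)[of a] by (simp only: sum.distrib distrib_left mult.left_commute flip: sum_distrib_left)
  ultimately show ?thesis unfolding AVT_coeff_def restrict_UNIV by blast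
qed

context cuntz_pimsner_algebra
begin

lemma AVT_fixed_convex:
  assumes "\<phi> \<in> AVT_fixed d \<iota> S" "\<phi>' \<in> AVT_fixed d \<iota> S" "t \<in> {0..1}"
  shows "(\<lambda>x\<in>fixed. of_real t * \<phi> x + of_real (1 - t) * \<phi>' x) \<in> AVT_fixed d \<iota> S"
proof -
  have av: "\<phi> f = (1 / of_nat d) * (\<Sum>i=1..d. \<phi> (star (S i) * f * S i))"
    "\<phi>' f = (1 / of_nat d) * (\<Sum>i=1..d. \<phi>' (star (S i) * f * S i))" if "f \<in> fixed" for f
    using assms that unfolding AVT_fixed_def by blast+
  have st: "(\<lambda>x\<in>fixed. of_real t * \<phi> x + of_real (1 - t) * \<phi>' x) \<in> tracial_states fixed"
  proof (intro tracial_states_convex)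
    show "\<phi> \<in> tracial_states fixed" "\<phi>' \<in> tracial_states fixed"
      using assms unfolding AVT_fixed_def by blast+
  qed (simp_all add: fixed_sub one_fixed assms(3) del: atLeastAtMost_iff)
  have eq: "of_real t * \<phi> f + of_real (1 - t) * \<phi>' f = (1 / of_nat d) *
      (\<Sum>i=1..d. of_real t * \<phi> (star (S i) * f * S i) + of_real (1 - t) * \<phi>' (star (S i) * f * S i))"
    if "f \<in> fixed" for f
    unfolding av(1)[OF that] av(2)[OF that]
    by (simp only: sum.distrib distrib_left mult.left_commute flip: sum_distrib_left)
  show ?thesis
    unfolding AVT_fixed_def
  proof (intro CollectI conjI ballI)
    fix f assume f: "f \<in> fixed"
    show "(\<lambda>x\<in>fixed. of_real t * \<phi> x + of_real (1 - t) * \<phi>' x) f = (1 / of_nat d) *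
        (\<Sum>i=1..d. (\<lambda>x\<in>fixed. of_real t * \<phi> x + of_real (1 - t) * \<phi>' x) (star (S i) * f * S i))"
      using eq[OF f] f by (simp add: S_fixed_S del: of_real_diff)
  qed (rule st)
qed

section \<open>Restriction maps and their surjectivity\<close>

lemma restrict_AVT_fixed:
  assumes \<phi>: "\<phi> \<in> AVT_fixed d \<iota> S" shows "(\<lambda>a\<in>UNIV. \<phi> (\<iota> a)) \<in> AVT_coeff d \<alpha>"
proof -
  have st: "\<phi> \<in> states fixed" and tr: "\<And>x y. \<lbrakk>x \<in> fixed; y \<in> fixed\<rbrakk> \<Longrightarrow> \<phi> (x * y) = \<phi> (y * x)"
    and av: "\<And>f. f \<in> fixed \<Longrightarrow> \<phi> f = (1 / of_nat d) * (\<Sum>i=1..d. \<phi> (star (S i) * f * S i))"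
    using \<phi> unfolding AVT_fixed_def tracial_states_def by blast+
  have "\<phi> (\<iota> (star a * a)) \<in> nonneg_Reals" for a
    using states_pos[OF st iota_fixed[of a]] by (simp add: iota_mult iota_star)
  moreover have "cmod (\<phi> (\<iota> a)) \<le> norm a" for a
    using states_norm_le[OF st iota_fixed[of a]] by (simp add: iota_norm)
  ultimately have "(\<lambda>a. \<phi> (\<iota> a)) \<in> states UNIV"
    by (simp add: states_def iota_add iota_scaleC iota_one
        states_add[OF st] states_scaleC[OF st] states_one[OF st] iota_fixed)
  then have "(\<lambda>a. \<phi> (\<iota> a)) \<in> tracial_states UNIV"
    by (simp add: tracial_states_def iota_mult tr iota_fixed)
  moreover have "\<phi> (\<iota> a) = (1 / of_nat d) * (\<Sum>i=1..d. \<phi> (\<iota> (\<alpha> i a)))" for a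
    by (subst av[OF iota_fixed]) (simp add: iota_alpha)
  ultimately show ?thesis unfolding AVT_coeff_def restrict_UNIV by blast
qed

text \<open>For p = q the powers of d cancel and the graded identity is the trace property; diagonal
  elements are dense in the fixed point algebra. Averaging is invariance under L.\<close>

lemma restrict_graded_KMS:
  assumes \<psi>: "\<psi> \<in> graded_KMS" shows "(\<lambda>f\<in>fixed. \<psi> f) \<in> AVT_fixed d \<iota> S"
proof -
  note st = graded_KMS_state[OF \<psi>]
  note lin = states_bounded_linear[OF st]
  have trace: "\<psi> (x * y) = \<psi> (y * x)" if x: "x \<in> fixed" for x y
  proof -
    have "x \<in> closure (\<Union>n. bideg n n)"
      unfolding closure_approachable
      by (metis UN_I UNIV_I dist_commute dist_norm fixed_approx[OF x])
    moreover have "closure (\<Union>n. bideg n n) \<subseteq> {x. \<psi> (x * y) = \<psi> (y * x)}"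
    proof (rule closure_minimal)
      show "(\<Union>n. bideg n n) \<subseteq> {x. \<psi> (x * y) = \<psi> (y * x)}"
        using graded_KMS_mult[OF \<psi>, of _ n n for n] d by fastforce
    qed (intro closed_Collect_eq continuous_intros bounded_linear.continuous_on[OF lin])
    ultimately show ?thesis by blast
  qed
  have average: "\<psi> f = (1 / of_nat d) * (\<Sum>i=1..d. \<psi> (star (S i) * f * S i))" for f
    using graded_KMS_transfer[OF \<psi>, of f]
    by (simp add: transfer_def scaleR_scaleC states_scaleC[OF st]
        linear_sum[OF bounded_linear.linear[OF lin]])
  have "restrict \<psi> fixed f =
      (1 / of_nat d) * (\<Sum>i=1..d. restrict \<psi> fixed (star (S i) * f * S i))" if "f \<in> fixed" for f
    using average[of f] that by (simp add: S_fixed_S)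
  moreover have "restrict \<psi> fixed \<in> states fixed"
    by (simp add: states_def fixed_sub one_fixed states_add[OF st]
        states_scaleC[OF st] states_pos[OF st] states_norm_le[OF st] states_one[OF st])
  then have "restrict \<psi> fixed \<in> tracial_states fixed"
    by (simp add: tracial_states_def fixed_sub trace)
  ultimately show ?thesis unfolding AVT_fixed_def by blast
qed

lemma graded_KMS_onto_AVT_coeff:
  assumes "\<tau> \<in> AVT_coeff d \<alpha>" shows "\<exists>\<psi>\<in>graded_KMS. \<forall>a. \<psi> (\<iota> a) = \<tau> a"
proof -
  interpret averaging_trace d \<alpha> \<iota> S \<tau> by unfold_locales (rule assms)
  show ?thesis using graded_KMS_extension by blast
qed

text \<open>The restriction of \<open>\<phi>\<close> to A extends to a KMS state. On the fixed point
  algebra this state and \<open>\<phi>\<close> are averaging traces with equal values on A, and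
  \<open>AVT_fixed_approx\<close> makes them coincide.\<close>

lemma graded_KMS_onto_AVT_fixed:
  assumes \<phi>: "\<phi> \<in> AVT_fixed d \<iota> S" shows "\<exists>\<psi>\<in>graded_KMS. \<forall>f\<in>fixed. \<psi> f = \<phi> f"
proof -
  obtain \<psi> where \<psi>: "\<psi> \<in> graded_KMS" "\<And>a. \<psi> (\<iota> a) = \<phi> (\<iota> a)"
    using graded_KMS_onto_AVT_coeff[OF restrict_AVT_fixed[OF \<phi>]] by auto
  have "\<psi> f = \<phi> f" if f: "f \<in> fixed" for f
  proof (rule ccontr)
    assume "\<psi> f \<noteq> \<phi> f"
    then have e: "cmod (\<psi> f - \<phi> f) / 2 > 0" by simp
    obtain a where a: "\<And>\<phi>'. \<phi>' \<in> AVT_fixed d \<iota> S \<Longrightarrow>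
        cmod (\<phi>' f - \<phi>' (\<iota> a)) < cmod (\<psi> f - \<phi> f) / 2"
      using AVT_fixed_approx[OF f e] by blast
    have "cmod (\<psi> f - \<phi> (\<iota> a)) < cmod (\<psi> f - \<phi> f) / 2"
      using a[OF restrict_graded_KMS[OF \<psi>(1)]] f by (simp add: iota_fixed \<psi>(2))
    then show False
      using a[OF \<phi>] norm_triangle_ineq4[of "\<psi> f - \<phi> (\<iota> a)" "\<phi> f - \<phi> (\<iota> a)"] by simp
  qed
  then show ?thesis using \<psi>(1) by blast
qed

section \<open>The three homeomorphisms\<close>

lemma AVT_fixed_extensional: "AVT_fixed d \<iota> S \<subseteq> extensional fixed"
  unfolding AVT_fixed_def tracial_states_def states_def by blast

lemma AVT_coeff_AVT_fixed:
  "affinely_weak_star_homeomorphic UNIV (AVT_coeff d \<alpha>) fixed (AVT_fixed d \<iota> S)"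
proof (rule affinely_weak_star_homeomorphic_by_restriction[where j = \<iota>,
      OF AVT_fixed_extensional _ iota_fixed restrict_AVT_fixed _ _ AVT_coeff_convex])
  \<comment> \<open>Surjectivity passes through the whole algebra: \<tau> is extended to a KMS
    state, which is then restricted to \<open>fixed\<close>.\<close>
  show "\<exists>\<phi>\<in>AVT_fixed d \<iota> S. \<forall>a\<in>UNIV. \<phi> (\<iota> a) = \<tau> a" if \<tau>: "\<tau> \<in> AVT_coeff d \<alpha>" for \<tau>
    using graded_KMS_onto_AVT_coeff[OF \<tau>] restrict_graded_KMS iota_fixed
    by (metis restrict_apply')
  show "\<exists>a\<in>UNIV. \<forall>\<phi>\<in>AVT_fixed d \<iota> S. cmod (\<phi> f - \<phi> (\<iota> a)) < e"
    if "f \<in> fixed" "e > 0" for f e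
    using AVT_fixed_approx[OF that] by (metis UNIV_I)
qed simp_all

lemma AVT_fixed_graded_KMS:
  "affinely_weak_star_homeomorphic fixed (AVT_fixed d \<iota> S) UNIV graded_KMS"
proof (rule affinely_weak_star_homeomorphic_by_restriction[where j = "\<lambda>f. f",
      OF _ AVT_fixed_extensional _ restrict_graded_KMS graded_KMS_onto_AVT_fixed _ AVT_fixed_convex])
  show "\<exists>f\<in>fixed. \<forall>\<psi>\<in>graded_KMS. cmod (\<psi> x - \<psi> f) < e" if "e > 0" for x and e :: real
    using graded_KMS_approx[OF that, of x] iota_fixed by metis
qed simp_all

lemma AVT_coeff_graded_KMS:
  "affinely_weak_star_homeomorphic UNIV (AVT_coeff d \<alpha>) UNIV graded_KMS"
proof (rule affinely_weak_star_homeomorphic_by_restriction[where j = \<iota>,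
      OF _ _ _ _ _ _ AVT_coeff_convex])
  show "(\<lambda>a\<in>UNIV. \<psi> (\<iota> a)) \<in> AVT_coeff d \<alpha>" if "\<psi> \<in> graded_KMS" for \<psi>
    using restrict_AVT_fixed[OF restrict_graded_KMS[OF that]] by (simp add: iota_fixed)
  show "\<exists>a\<in>UNIV. \<forall>\<psi>\<in>graded_KMS. cmod (\<psi> x - \<psi> (\<iota> a)) < e" if "e > 0" for x and e :: real
    using graded_KMS_approx[OF that, of x] by (metis UNIV_I)
qed (simp_all add: graded_KMS_onto_AVT_coeff)

end

theorem proposition3p11:
  fixes d :: nat
    and \<alpha> :: "nat \<Rightarrow> 'a::cstar_algebra \<Rightarrow> 'a"
    and \<iota> :: "'a \<Rightarrow> 'b::cstar_algebra"
    and S :: "nat \<Rightarrow> 'b"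
  assumes "d > 1"
    and "unital_cstar_system d \<alpha>"
    and "injective_system d \<alpha>"
    and "cuntz_pimsner d \<alpha> \<iota> S"
  shows "affinely_weak_star_homeomorphic
           UNIV (AVT_coeff d \<alpha>)
           (gauge_fixed d \<iota> S) (AVT_fixed d \<iota> S) \<and>
         affinely_weak_star_homeomorphic
           (gauge_fixed d \<iota> S) (AVT_fixed d \<iota> S)
           UNIV (KMS_states (gauge_flow d \<iota> S) (ln (real d))) \<and>
         affinely_weak_star_homeomorphic
           UNIV (AVT_coeff d \<alpha>)
           UNIV (KMS_states (gauge_flow d \<iota> S) (ln (real d)))"
proof -
  interpret cuntz_pimsner_algebra d \<alpha> \<iota> S
    by unfold_locales (rule assms)+
  show ?thesis
    unfolding KMS_eq_graded_KMS
    by (intro conjI AVT_coeff_AVT_fixed AVT_fixed_graded_KMS AVT_coeff_graded_KMS)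
qed

end
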